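(* Let $p',q'\in\mathbb{N}$ with $q'\ge p'\ge1$. Let real numbers be given such that $b_j\ge0$ ($j=1,\dots,q'-p'$), $c_j\ge0$ and $d_j\ge c_j+1$ ($j=1,\dots,p'-1$), and $o_1\ge0$. Assume moreover that $\beta+l\ne -l'$ for every $\beta\in\{b_1,\dots,b_{q'-p'},c_1,\dots,c_{p'-1},o_1\}$ and all $l,l'\in\mathbb{N}_0$. Then $$E\left[b_1,\dots,b_{q'-p'},c_1,\dots,c_{p'-1},o_1;\,d_1,\dots,d_{p'-1};\,t\right]>0\qquad\text{for every }t>0.$$
   Context: $\mathbb{N}=\{1,2,\dots\}$, $\mathbb{N}_0=\mathbb{N}\cup\{0\}$. The notation $(x_j,X_j)_1^l$ stands for the list $(x_1,X_1),\dots,(x_l,X_l)$ (the empty list if $l=0$); lists separated by commas are concatenated. MacRobert's $E$-function: $$E[\beta_1,\dots,\beta_q;\alpha_1,\dots,\alpha_{p-1};z]=H^{q,1}_{p,q}\left[z\,\Big|\begin{array}{c}(1,1),(\alpha_j,1)_1^{p-1}\\(\beta_j,1)_1^q\end{array}\right].$$ Fox $H$-function. For $0\le n\le p$, $0\le m\le q$, $A_j,B_j>0$, $\alpha_j,\beta_j\in\mathbb{C}$ with $A_j(l+\beta_{j'})\ne B_{j'}(\alpha_j-l'-1)$ for all $1\le j\le n$, $1\le j'\le m$, $l,l'\in\mathbb{N}_0$, put $$\Xi^{m,n}_{p,q}(s)=\frac{\prod_{j=1}^m\Gamma(\beta_j+B_js)\prod_{j=1}^n\Gamma(1-\alpha_j-A_js)}{\prod_{j=m+1}^q\Gamma(1-\beta_j-B_js)\prod_{j=n+1}^p\Gamma(\alpha_j+A_js)}$$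 (empty products are $1$), and $$H^{m,n}_{p,q}\left[z\,\Big|\begin{array}{c}(\alpha_j,A_j)_1^p\\(\beta_j,B_j)_1^q\end{array}\right]=\frac{1}{2\pi i}\int_{\mathcal C}\Xi^{m,n}_{p,q}(s)\,z^{-s}\,ds .$$ Let $\chi=\sum_{j=1}^nA_j-\sum_{j=n+1}^pA_j+\sum_{j=1}^mB_j-\sum_{j=m+1}^qB_j$. When $\chi>0$ (as is the case here) and $z>0$, $\mathcal C$ is a contour going from $\gamma-i\infty$ to $\gamma+i\infty$ ($\gamma\in\mathbb{R}$), leaving all poles of $\Gamma(\beta_j+B_js)$, $1\le j\le m$, on its left and all poles of $\Gamma(1-\alpha_j-A_js)$, $1\le j\le n$, on its right; the integral converges and does not depend on the choice of such a contour. *)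

theory Defs
  imports "HOL-Complex_Analysis.Complex_Analysis"
begin

text \<open>
  The upper parameter list \<open>as\<close> holds the pairs \<open>(\<alpha>\<^sub>j, A\<^sub>j)\<close> and the lower one \<open>bs\<close> the pairs
  \<open>(\<beta>\<^sub>j, B\<^sub>j)\<close>; thus \<open>p = length as\<close> and \<open>q = length bs\<close>. Lists are indexed from \<open>0\<close>, so
  \<open>1 \<le> j \<le> n\<close> becomes \<open>j < n\<close>.

  At a pole of a Gamma factor in the denominator the quotient is \<open>0\<close> (as \<open>Gamma\<close> is \<open>0\<close> there
  and division by \<open>0\<close> gives \<open>0\<close>), which is the right value because the reciprocal of Gamma is
  entire and vanishes at that point.
\<close>

definition fox_kernel ::
    "nat \<Rightarrow> nat \<Rightarrow> (complex \<times> real) list \<Rightarrow> (complex \<times> real) list \<Rightarrow> complex \<Rightarrow> complex" where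
  "fox_kernel m n as bs s =
     ((\<Prod>j<m. Gamma (fst (bs ! j) + of_real (snd (bs ! j)) * s)) *
      (\<Prod>j<n. Gamma (1 - fst (as ! j) - of_real (snd (as ! j)) * s))) /
     ((\<Prod>j=m..<length bs. Gamma (1 - fst (bs ! j) - of_real (snd (bs ! j)) * s)) *
      (\<Prod>j=n..<length as. Gamma (fst (as ! j) + of_real (snd (as ! j)) * s)))"

definition left_poles :: "nat \<Rightarrow> (complex \<times> real) list \<Rightarrow> complex set" where
  "left_poles m bs =
     {w. \<exists>j<m. is_pole (\<lambda>s. Gamma (fst (bs ! j) + of_real (snd (bs ! j)) * s)) w}"

definition right_poles :: "nat \<Rightarrow> (complex \<times> real) list \<Rightarrow> complex set" where
  "right_poles n as =
     {w. \<exists>j<n. is_pole (\<lambda>s. Gamma (1 - fst (as ! j) - of_real (snd (as ! j)) * s)) w}"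

text \<open>
  The real part of a curve going from \<open>\<gamma> - \<i>\<infinity>\<close> to \<open>\<gamma> + \<i>\<infinity>\<close> is bounded. Since the curve runs
  upwards, its left side is the component of its complement that contains all real numbers
  close to \<open>-\<infinity>\<close>, and its right side the component containing all real numbers close to \<open>+\<infinity>\<close>.
\<close>

definition left_of :: "(real \<Rightarrow> complex) \<Rightarrow> complex set" where
  "left_of g =
     {w. eventually (\<lambda>x. connected_component (- range g) w (complex_of_real x)) at_bot}"

definition right_of :: "(real \<Rightarrow> complex) \<Rightarrow> complex set" where
  "right_of g =
     {w. eventually (\<lambda>x. connected_component (- range g) w (complex_of_real x)) at_top}"

definition vertical_contour :: "real \<Rightarrow> (real \<Rightarrow> complex) \<Rightarrow> bool" where
  "vertical_contour \<gamma> g \<longleftrightarrow>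
     (\<forall>a b. g piecewise_C1_differentiable_on {a..b}) \<and> inj g \<and>
     filterlim (\<lambda>t. Im (g t)) at_bot at_bot \<and> ((\<lambda>t. Re (g t)) \<longlongrightarrow> \<gamma>) at_bot \<and>
     filterlim (\<lambda>t. Im (g t)) at_top at_top \<and> ((\<lambda>t. Re (g t)) \<longlongrightarrow> \<gamma>) at_top"

text \<open>
  The Fox H-function for \<open>z > 0\<close>, in the case
  \<open>\<chi> = (\<Sum>j\<le>n. A\<^sub>j) - (\<Sum>j>n. A\<^sub>j) + (\<Sum>j\<le>m. B\<^sub>j) - (\<Sum>j>m. B\<^sub>j) > 0\<close>, where the contours below
  are the appropriate ones and all give the same value. The Henstock-Kurzweil integral over
  \<open>UNIV\<close> is the (possibly conditionally convergent) improper integral along the contour.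
\<close>

definition fox_H ::
    "nat \<Rightarrow> nat \<Rightarrow> (complex \<times> real) list \<Rightarrow> (complex \<times> real) list \<Rightarrow> real \<Rightarrow> complex" where
  "fox_H m n as bs z =
     (THE h. \<exists>\<gamma> g. vertical_contour \<gamma> g \<and>
        left_poles m bs \<subseteq> left_of g \<and> right_poles n as \<subseteq> right_of g \<and>
        ((\<lambda>t. fox_kernel m n as bs (g t) * of_real z powr (- g t) * vector_derivative g (at t))
           has_integral (2 * of_real pi * \<i> * h)) UNIV)"

text \<open>
  Here \<open>m = q = length \<beta>s\<close>, \<open>n = 1\<close> and \<open>p = length \<alpha>s + 1\<close>, so \<open>\<chi> = q - p + 2\<close>.
\<close>

definition macrobert_E :: "complex list \<Rightarrow> complex list \<Rightarrow> real \<Rightarrow> complex" where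
  "macrobert_E \<beta>s \<alpha>s z =
     fox_H (length \<beta>s) 1 ((1, 1) # map (\<lambda>\<alpha>. (\<alpha>, 1)) \<alpha>s) (map (\<lambda>\<beta>. (\<beta>, 1)) \<beta>s) z"

end

(*
  On the line Re s = -eps each factor Gamma(beta + s) and each quotient Gamma(gamma + s) / Gamma(delta + s)
  is a function of Im s with the integral representation of a characteristic function (Gamma and Beta
  integrals), up to a positive constant, while Gamma(-s) is the Fourier transform of a strictly positive
  density, by Mellin inversion of exp(-x). Multiplying by characteristic functions averages translates of
  that density, so the inverse Fourier transform of the product stays strictly positive.

  That every admissible contour gives the same value as the line follows from the homology form of
  Cauchy's theorem: the piece of the contour between two far points, closed up along the line, has winding
  number 0 around every pole, since a pole can be joined to infinity on its own side of the contour. No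
  Stirling estimate is needed: the functional equation alone gives |Gamma(s)| = O(1 / (Im s)^2) on vertical
  strips.
*)

theory Submission
  imports Defs
begin

section \<open>Bounds and integrals for Gamma and Beta\<close>

text \<open>\<open>fox_H\<close> is a definite description over all admissible contours. Its value
  is known only once one contour with a convergent integral has been exhibited and every other such
  contour has been shown to agree with it.

  The obstacle is that the sides of a contour are given merely as components of the complement of
  its range, and that there are infinitely many poles. For a single pole the winding number
  comparison holds only from some truncation on, and that threshold depends on the pole. Since the
  real part of the contour is bounded, only finitely many poles need such a threshold; a real ray
  separates each of the others from the whole curve.

  The non-vanishing hypothesis with \<open>l = l' = 0\<close> makes the non-negative lower
  parameters strictly positive. This opens a gap between the poles of the factors
  \<open>Gamma (\<beta> + s)\<close> and the poles \<open>0, 1, 2, ...\<close> of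
  \<open>Gamma (- s)\<close>, and the line is placed in that gap. The factor
  \<open>Gamma (- s)\<close> has two tasks: it is the strictly positive starting point, and it
  supplies the decay. The remaining factors are used only as bounded functions away from the real
  axis and as characteristic functions on the line.\<close>

lemma not_nonpos_Int_complex: "Re z > 0 \<or> Im z \<noteq> 0 \<Longrightarrow> z \<notin> \<int>\<^sub>\<le>\<^sub>0"
  by (auto elim!: nonpos_Ints_cases)

lemma norm_Gamma_le:
  fixes z :: complex
  assumes "Re z > 0"
  shows "norm (Gamma z) \<le> Gamma (Re z)"
proof -
  note c = Gamma_integral_complex[OF assms] and r = Gamma_integral_real[OF assms]
  have "norm (integral {0..} (\<lambda>t. of_real t powr (z - 1) / of_real (exp t)))
          \<le> integral {0..} (\<lambda>t. t powr (Re z - 1) / exp t)"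
    using c r
    by (intro integral_norm_bound_integral) (auto simp: norm_divide norm_powr_real_powr has_integral_iff)
  then show ?thesis
    using c r by (simp add: has_integral_iff)
qed

text \<open>Shifting by \<open>n\<close> moves the strip into the right half-plane, where the
  modulus is at most the real Gamma function on a compact interval. The shift costs division by a
  Pochhammer symbol with \<open>n \<ge> 2\<close> factors, each of modulus at least
  \<open>\<bar>Im w\<bar>\<close>.\<close>

lemma Gamma_decay_on_strip:
  fixes R :: real
  obtains C where "C \<ge> 0" "\<And>w. \<bar>Re w\<bar> \<le> R \<Longrightarrow> 1 \<le> \<bar>Im w\<bar> \<Longrightarrow> norm (Gamma w) \<le> C / (Im w)\<^sup>2"
proof -
  \<comment> \<open>With this \<open>n\<close> the abscissa \<open>Re w + n\<close> stays in
    \<open>[1, 2 n]\<close>; the summand 2 also secures the exponent 2 of the decay.\<close>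
  define n where "n = nat \<lceil>R\<rceil> + 2"
  have nR: "real n \<ge> R + 2" "n \<ge> 2"
    unfolding n_def by linarith+
  have "continuous_on {1..2 * real n} (Gamma :: real \<Rightarrow> real)"
    by (intro continuous_intros) (auto elim!: nonpos_Ints_cases)
  then have "bounded ((Gamma :: real \<Rightarrow> real) ` {1..2 * real n})"
    by (intro compact_imp_bounded compact_continuous_image) auto
  then obtain C where C: "\<And>x. x \<in> {1..2 * real n} \<Longrightarrow> \<bar>Gamma x\<bar> \<le> C"
    unfolding bounded_iff by (metis imageI real_norm_def)
  have "C \<ge> 0" using C[of 1] nR by auto
  moreover have "norm (Gamma w) \<le> C / (Im w)\<^sup>2" if "\<bar>Re w\<bar> \<le> R" "1 \<le> \<bar>Im w\<bar>" for w
  proof -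
    have w: "w \<notin> \<int>\<^sub>\<le>\<^sub>0" "w + of_nat n \<notin> \<int>\<^sub>\<le>\<^sub>0"
      using that by (auto intro!: not_nonpos_Int_complex)
    have "(Im w)\<^sup>2 \<le> \<bar>Im w\<bar> ^ n"
      using power_increasing[of 2 n "\<bar>Im w\<bar>"] that nR by simp
    also have "\<dots> = (\<Prod>k<n. \<bar>Im w\<bar>)" by simp
    also have "\<dots> \<le> (\<Prod>k<n. norm (w + of_nat k))"
      by (intro prod_mono conjI) (use abs_Im_le_cmod[of "w + of_nat _"] in auto)
    also have "\<dots> = norm (pochhammer w n)"
      by (simp add: pochhammer_prod prod_norm atLeast0LessThan)
    finally have poch: "(Im w)\<^sup>2 \<le> norm (pochhammer w n)" .
    have "Im w \<noteq> 0" using that by auto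
    then have im: "(Im w)\<^sup>2 > 0" by simp
    have "Gamma w = Gamma (w + of_nat n) / pochhammer w n"
      using w poch im by (subst pochhammer_Gamma[OF w(1)]) (auto simp: Gamma_eq_zero_iff pochhammer_Gamma[OF w(1)])
    then have "norm (Gamma w) = norm (Gamma (w + of_nat n)) / norm (pochhammer w n)"
      by (simp add: norm_divide)
    also have "norm (Gamma (w + of_nat n)) \<le> Gamma (Re (w + of_nat n))"
      using that nR by (intro norm_Gamma_le) simp
    also have "\<dots> \<le> C"
      using C[of "Re (w + of_nat n)"] that nR by force
    finally have "norm (Gamma w) \<le> C / norm (pochhammer w n)"
      by (simp add: divide_right_mono)
    also have "\<dots> \<le> C / (Im w)\<^sup>2"
      using poch im \<open>C \<ge> 0\<close> by (intro divide_left_mono mult_pos_pos) auto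
    finally show ?thesis .
  qed
  ultimately show thesis by (rule that)
qed

section \<open>Convolution of Gamma densities and the Beta integral with one complex
  argument\<close>

lemma integral_convolution:
  fixes f g :: "real \<Rightarrow> 'a :: {banach, second_countable_topology, real_normed_field}"
  assumes f: "integrable lborel f" and g: "integrable lborel g"
  shows "(LINT r|lborel. (LINT x|lborel. f x * g (r - x))) = integral\<^sup>L lborel f * integral\<^sup>L lborel g"
proof -
  have [measurable]: "f \<in> borel_measurable borel" "g \<in> borel_measurable borel"
    using f g by auto
  have shift: "integrable lborel (\<lambda>r. g (r - x))" "(LINT r|lborel. g (r - x)) = integral\<^sup>L lborel g"
       "(LINT r|lborel. norm (g (r - x))) = (LINT r|lborel. norm (g r))" for x
    using lborel_integrable_real_affine[OF g, of 1 "-x"] lborel_integral_real_affine[of 1 g "-x"]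
      lborel_integral_real_affine[of 1 "\<lambda>r. norm (g r)" "-x"] by simp_all
  have "integrable (lborel \<Otimes>\<^sub>M lborel) (\<lambda>(x, r). f x * g (r - x))"
  proof (rule lborel_pair.Fubini_integrable)
    show "integrable lborel (\<lambda>x. LINT r|lborel. norm (case (x, r) of (x, r) \<Rightarrow> f x * g (r - x)))"
      using f by (simp add: norm_mult shift)
  qed (use shift in auto)
  from lborel_pair.Fubini_integral[OF this]
  have "(LINT r|lborel. (LINT x|lborel. f x * g (r - x))) = (LINT x|lborel. (LINT r|lborel. f x * g (r - x)))" .
  then show ?thesis using f by (simp add: shift)
qed

lemma Beta_integrable_complex:
  assumes "Re a > 0" "k > 0"
  shows "integrable lborel (\<lambda>t. indicator {0<..<1} t *\<^sub>R (of_real t powr (a - 1) * of_real ((1 - t) powr (k - 1))) :: complex)"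
proof -
  have "integrable lborel (\<lambda>t. indicator {0..1} t *\<^sub>R (t powr (Re a - 1) * (1 - t) powr (k - 1)))"
    using integrable_Beta[OF assms] by (simp add: set_integrable_def)
  then show ?thesis
    by (rule Bochner_Integration.integrable_bound)
       (auto simp: norm_mult norm_powr_real_powr indicator_def)
qed

lemma Gamma_integral_Bochner:
  assumes "Re z > 0"
  shows "integrable lborel (\<lambda>t. indicator {0<..} t *\<^sub>R (of_real t powr (z - 1) * of_real (exp (- t))) :: complex)"
    and "(LINT t|lborel. indicator {0<..} t *\<^sub>R (of_real t powr (z - 1) * of_real (exp (- t)))) = Gamma z"
proof -
  have e: "(\<lambda>t. indicator {0<..} t *\<^sub>R (complex_of_real t powr (z - 1) / of_real (exp t))) = 
     (\<lambda>t. indicator {0<..} t *\<^sub>R (of_real t powr (z - 1) * of_real (exp (- t))))"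
    by (auto simp: exp_minus field_simps)
  have a: "set_integrable lborel {0<..} (\<lambda>t. complex_of_real t powr (z - 1) / of_real (exp t))"
    using absolutely_integrable_Gamma_integral'[OF assms]
    unfolding absolutely_integrable_on_def set_integrable_def
    by (subst (asm) integrable_completion) (auto simp: absolutely_integrable_on_def)
  then show "integrable lborel (\<lambda>t. indicator {0<..} t *\<^sub>R (of_real t powr (z - 1) * of_real (exp (- t))) :: complex)"
    by (simp add: e set_integrable_def)
  from set_borel_integral_eq_integral(2)[OF a] Gamma_integral_complex'[OF assms]
  show "(LINT t|lborel. indicator {0<..} t *\<^sub>R (of_real t powr (z - 1) * of_real (exp (- t)))) = Gamma z"
    by (simp add: has_integral_iff e set_lebesgue_integral_def)
qed

text \<open>The functions \<open>t powr (z - 1) * exp (- t)\<close> on the positive axis form a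
  convolution family: those for \<open>a\<close> and \<open>k\<close> convolve to the one for
  \<open>a + k\<close> times the Beta integral. Integrating the convolution gives the product of the
  two Gamma values. The second argument stays real because it will be a difference of two real
  parameters.\<close>

lemma Beta_integral_complex:
  assumes a: "Re a > 0" and k: "k > 0"
  shows "(LINT t|lborel. indicator {0<..<1} t *\<^sub>R (of_real t powr (a - 1) * of_real ((1 - t) powr (k - 1))))
           = Beta a (of_real k)"
proof -
  let ?f = "\<lambda>z t. indicator {0<..} t *\<^sub>R (of_real t powr (z - 1) * of_real (exp (- t))) :: complex"
  let ?B = "LINT t|lborel. indicator {0<..<1} t *\<^sub>R (of_real t powr (a - 1) * complex_of_real ((1 - t) powr (k - 1)))"
  have k': "Re (complex_of_real k) > 0" and ak: "Re (a + of_real k) > 0" using assms by auto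
  have inner: "(LINT x|lborel. ?f a x * ?f (of_real k) (r - x)) = ?f (a + of_real k) r * ?B" for r
  proof (cases "r > 0")
    case True
    \<comment> \<open>After the substitution \<open>x = r v\<close> the exponentials combine to
      \<open>exp (- r)\<close> and all dependence on \<open>v\<close> is the Beta integrand. The
      Jacobian \<open>r\<close> later raises the exponent from \<open>a + k - 2\<close> to
      \<open>a + k - 1\<close>.\<close>
    have eq: "?f a (r * v) * ?f (of_real k) (r - r * v) =
         (of_real r powr (a + of_real k - 2) * of_real (exp (- r))) *
          (indicator {0<..<1} v *\<^sub>R (of_real v powr (a - 1) * of_real ((1 - v) powr (k - 1))))" for v
    proof (cases "v \<in> {0<..<1}")
      case v: True
      have rv: "r - r * v = r * (1 - v)" by (simp add: algebra_simps)
      have "?f a (r * v) * ?f (of_real k) (r - r * v) = 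
         (of_real r powr (a - 1) * of_real v powr (a - 1) * of_real (exp (- r * v))) * 
         (of_real r powr (of_real k - 1) * of_real ((1 - v) powr (k - 1)) * of_real (exp (- (r * (1 - v)))))"
        using v True unfolding rv of_real_mult
        by (subst (1 2) powr_times_real)
           (auto simp: powr_of_real[symmetric] powr_of_real)
      also have "\<dots> = (of_real r powr (a - 1) * of_real r powr (of_real k - 1)) * of_real (exp (- r * v) * exp (- (r * (1 - v)))) * 
          (of_real v powr (a - 1) * of_real ((1 - v) powr (k - 1)))"
        by simp
      also have "exp (- r * v) * exp (- (r * (1 - v))) = exp (- r)"
        by (simp add: exp_add[symmetric] algebra_simps)
      also have "of_real r powr (a - 1) * of_real r powr (of_real k - 1) = of_real r powr (a + complex_of_real k - 2)"
        by (subst powr_add[symmetric]) (simp add: algebra_simps)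
      finally show ?thesis using v by simp
    qed (use True in \<open>auto simp: indicator_def mult_less_0_iff zero_less_mult_iff\<close>)
    have "(LINT x|lborel. ?f a x * ?f (of_real k) (r - x)) =
       r *\<^sub>R (LINT v|lborel. ?f a (r * v) * ?f (of_real k) (r - r * v))"
      using lborel_integral_real_affine[of r "\<lambda>x. ?f a x * ?f (of_real k) (r - x)" 0] True by simp
    also have "\<dots> = r *\<^sub>R ((of_real r powr (a + of_real k - 2) * of_real (exp (- r))) * ?B)"
      by (simp only: eq integral_mult_right_zero)
    also have "of_real r powr (a + of_real k - 1) = of_real r powr (a + of_real k - 2) * complex_of_real r"
      using powr_add[of "complex_of_real r" "a + of_real k - 2" 1] True by (simp add: algebra_simps)
    then have "r *\<^sub>R ((of_real r powr (a + of_real k - 2) * of_real (exp (- r))) * ?B) = ?f (a + of_real k) r * ?B"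
      using True by (simp add: scaleR_conv_of_real)
    finally show ?thesis .
  next
    case False
    then have "?f a x * ?f (of_real k) (r - x) = 0" for x by (auto simp: indicator_def)
    then show ?thesis using False by (simp only: integral_zero) simp
  qed
  have "Gamma a * Gamma (of_real k) = (LINT r|lborel. ?f (a + of_real k) r * ?B)"
    using integral_convolution[OF Gamma_integral_Bochner(1)[OF a] Gamma_integral_Bochner(1)[OF k']]
    unfolding inner Gamma_integral_Bochner(2)[OF a] Gamma_integral_Bochner(2)[OF k'] by simp
  also have "\<dots> = Gamma (a + of_real k) * ?B"
    by (simp only: integral_mult_left_zero Gamma_integral_Bochner(2)[OF ak])
  finally have "Gamma a * Gamma (of_real k) = Gamma (a + of_real k) * ?B" .
  moreover have "Gamma (a + of_real k) \<noteq> 0"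
    using ak by (simp add: Gamma_eq_zero_iff not_nonpos_Int_complex)
  ultimately show ?thesis by (simp add: Beta_def)
qed

section \<open>Positivity of Fourier transforms\<close>

definition positive_fourier :: "(real \<Rightarrow> complex) \<Rightarrow> bool" where
  "positive_fourier G \<longleftrightarrow> integrable lborel G \<and>
     (\<forall>y. \<exists>r>0. (LINT u|lborel. G u * cis (- (u * y))) = complex_of_real r)"

text \<open>
  With \<open>x = e\<^sup>y\<close> this is the Fourier transform of a finite non-zero measure in \<open>y\<close>. The values of \<open>ln\<close> at
  \<open>x \<le> 0\<close> are harmless, since the densities used below vanish there.
\<close>

definition cf_of_density :: "(real \<Rightarrow> real) \<Rightarrow> (real \<Rightarrow> complex) \<Rightarrow> bool" where
  "cf_of_density v M \<longleftrightarrow> integrable lborel v \<and> (\<forall>x. 0 \<le> v x) \<and> 0 < integral\<^sup>L lborel v \<and>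
     (\<forall>u. M u = (LINT x|lborel. of_real (v x) * cis (u * ln x)))"

lemma cis_measurable [measurable]: "cis \<in> borel_measurable borel"
  by (intro borel_measurable_continuous_onI continuous_intros)

text \<open>If \<open>h\<close> is the transform of \<open>G\<close>, Fubini turns the transform of
  the product at \<open>y\<close> into the integral of \<open>v x * h (y - ln x)\<close>.\<close>

lemma positive_fourier_mult:
  assumes G: "positive_fourier G" and M: "cf_of_density v M"
  shows "positive_fourier (\<lambda>u. G u * M u)"
proof -
  have iG: "integrable lborel G" and pG: "\<And>y. \<exists>r>0. (LINT u|lborel. G u * cis (- (u * y))) = complex_of_real r"
    using G by (auto simp: positive_fourier_def)
  have iv: "integrable lborel v" and v0: "\<And>x. 0 \<le> v x" and vp: "0 < integral\<^sup>L lborel v"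
    and Meq: "\<And>u. M u = (LINT x|lborel. of_real (v x) * cis (u * ln x))"
    using M by (auto simp: cf_of_density_def)
  have [measurable]: "G \<in> borel_measurable borel" "v \<in> borel_measurable borel"
    using iG iv by auto
  obtain h where h: "\<And>y. h y > 0" "\<And>y. (LINT u|lborel. G u * cis (- (u * y))) = complex_of_real (h y)"
    using pG by metis
  have iM: "integrable lborel (\<lambda>x. of_real (v x) * cis (u * ln x))" for u
    by (rule Bochner_Integration.integrable_bound[OF iv]) (auto simp: norm_mult)
  have [measurable]: "M \<in> borel_measurable borel"
    unfolding Meq by measurable
  have Mb: "norm (M u) \<le> integral\<^sup>L lborel v" for u
    unfolding Meq
    using integral_norm_bound[of lborel "\<lambda>x. of_real (v x) * cis (u * ln x)"] v0 by (simp add: norm_mult)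
  have iGM: "integrable lborel (\<lambda>u. G u * M u)"
  proof (rule Bochner_Integration.integrable_bound)
    show "integrable lborel (\<lambda>u. integral\<^sup>L lborel v * norm (G u))"
      using iG by auto
    show "AE u in lborel. norm (G u * M u) \<le> norm (integral\<^sup>L lborel v * norm (G u))"
    proof (rule AE_I2)
      fix u show "norm (G u * M u) \<le> norm (integral\<^sup>L lborel v * norm (G u))"
        using Mb[of u] vp by (simp add: norm_mult mult.commute[of "cmod (G u)"] mult_right_mono)
    qed
  qed auto
  have "\<exists>r>0. (LINT u|lborel. G u * M u * cis (- (u * y))) = complex_of_real r" for y
  proof -
    let ?F = "\<lambda>u x. (G u * cis (- (u * y))) * (of_real (v x) * cis (u * ln x))"
    have "integrable (lborel \<Otimes>\<^sub>M lborel) (\<lambda>(u, x). ?F u x)"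
    proof (rule lborel_pair.Fubini_integrable)
      show "integrable lborel (\<lambda>u. LINT x|lborel. norm (case (u, x) of (u, x) \<Rightarrow> ?F u x))"
        using iG v0 by (simp add: norm_mult)
    qed (use iM in auto)
    from lborel_pair.Fubini_integral[OF this]
    have "(LINT u|lborel. (LINT x|lborel. ?F u x)) = (LINT x|lborel. (LINT u|lborel. ?F u x))" by simp
    moreover have "(LINT x|lborel. ?F u x) = G u * M u * cis (- (u * y))" for u
    proof -
      have "(LINT x|lborel. ?F u x) = (G u * cis (- (u * y))) * M u"
        unfolding Meq by (rule integral_mult_right_zero)
      then show ?thesis by simp
    qed
    moreover have "(LINT u|lborel. ?F u x) = complex_of_real (v x * h (y - ln x))" for x
    proof -
      have "?F u x = complex_of_real (v x) * (G u * cis (- (u * (y - ln x))))" for u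
      proof -
        have "cis (- (u * (y - ln x))) = cis (- (u * y)) * cis (u * ln x)"
          by (simp add: cis_mult algebra_simps)
        then show ?thesis by (simp only: mult.assoc mult.left_commute mult.commute)
      qed
      then have "(LINT u|lborel. ?F u x) = complex_of_real (v x) * (LINT u|lborel. G u * cis (- (u * (y - ln x))))"
        by (simp only: integral_mult_right_zero)
      then show ?thesis by (simp add: h(2))
    qed
    ultimately have eq: "(LINT u|lborel. G u * M u * cis (- (u * y))) = (LINT x|lborel. complex_of_real (v x * h (y - ln x)))"
      by (simp only:)
    have hb: "h y \<le> (LINT u|lborel. norm (G u))" for y
    proof -
      have "norm (complex_of_real (h y)) \<le> (LINT u|lborel. norm (G u * cis (- (u * y))))"
        unfolding h(2)[symmetric] by (rule integral_norm_bound)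
      then show ?thesis using h(1)[of y] by (simp add: norm_mult)
    qed
    \<comment> \<open>\<open>h\<close> was chosen pointwise, so its measurability is read off from
      the parametrised integral.\<close>
    have heq: "h = (\<lambda>y. Re (LINT u|lborel. G u * cis (- (u * y))))"
      by (simp add: h(2))
    have [measurable]: "h \<in> borel_measurable borel"
      unfolding heq by measurable
    have iv': "integrable lborel (\<lambda>x. v x * h (y - ln x))"
    proof (rule Bochner_Integration.integrable_bound)
      show "integrable lborel (\<lambda>x. (LINT u|lborel. norm (G u)) * v x)" using iv by simp
      show "AE x in lborel. norm (v x * h (y - ln x)) \<le> norm ((LINT u|lborel. norm (G u)) * v x)"
      proof (rule AE_I2)
        fix x show "norm (v x * h (y - ln x)) \<le> norm ((LINT u|lborel. norm (G u)) * v x)"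
          using hb[of "y - ln x"] h(1)[of "y - ln x"] v0[of x]
          by (simp add: abs_mult mult.commute[of "v x"] mult_right_mono)
      qed
    qed auto
    have nn: "0 \<le> v x * h (y - ln x)" for x using v0[of x] h(1)[of "y - ln x"] by simp
    \<comment> \<open>Strictness: since \<open>h\<close> vanishes nowhere, a zero integral would
      force \<open>v\<close> to vanish almost everywhere, against its positive mass.\<close>
    have "(LINT x|lborel. v x * h (y - ln x)) \<noteq> 0"
    proof
      assume "(LINT x|lborel. v x * h (y - ln x)) = 0"
      then have "AE x in lborel. v x * h (y - ln x) = 0"
        using integral_nonneg_eq_0_iff_AE[OF iv'] nn by simp
      then have "AE x in lborel. v x = 0"
        by eventually_elim (metis h(1) less_irrefl mult_eq_0_iff)
      then have "integral\<^sup>L lborel v = 0"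
        using integral_eq_zero_AE by blast
      with vp show False by simp
    qed
    moreover have "(LINT x|lborel. v x * h (y - ln x)) \<ge> 0" using nn by simp
    ultimately have "(LINT x|lborel. v x * h (y - ln x)) > 0" by linarith
    moreover have "(LINT x|lborel. complex_of_real (v x * h (y - ln x))) = of_real (LINT x|lborel. v x * h (y - ln x))"
      by (rule integral_complex_of_real)
    ultimately show ?thesis using eq by metis
  qed
  with iGM show ?thesis by (simp add: positive_fourier_def)
qed

section \<open>Gamma and Beta densities on a vertical line\<close>

lemma powr_Complex_of_real:
  assumes "x > 0"
  shows "of_real x powr Complex a u = of_real (x powr a) * cis (u * ln x)"
  using assms
  by (simp add: powr_def Ln_of_real cis_conv_exp exp_add[symmetric] exp_of_real[symmetric] Complex_eq algebra_simps)

lemma cf_of_density_Gamma: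
  assumes "\<sigma> + b > 0"
  shows "\<exists>v. cf_of_density v (\<lambda>u. Gamma (of_real b + Complex \<sigma> u))"
proof -
  define v where "v x = indicator {0<..} x * (x powr (\<sigma> + b - 1) * exp (- x))" for x :: real
  have eq: "(\<lambda>t. indicator {0<..} t *\<^sub>R (of_real t powr (of_real b + Complex \<sigma> u - 1) * of_real (exp (- t)))) =
       (\<lambda>x. complex_of_real (v x) * cis (u * ln x))" for u
  proof
    fix t
    have "of_real b + Complex \<sigma> u - 1 = Complex (\<sigma> + b - 1) u" by (simp add: complex_eq_iff)
    then show "indicator {0<..} t *\<^sub>R (of_real t powr (of_real b + Complex \<sigma> u - 1) * of_real (exp (- t))) =
       complex_of_real (v t) * cis (u * ln t)"
      by (simp add: v_def indicator_def powr_Complex_of_real)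
  qed
  have re: "Re (of_real b + Complex \<sigma> u) > 0" for u using assms by simp
  note I = Gamma_integral_Bochner[OF re, unfolded eq]
  \<comment> \<open>At \<open>u = 0\<close> the factor \<open>cis\<close> is 1, so this case yields
    both integrability and total mass of the real density.\<close>
  have iv: "integrable lborel v"
    using I(1)[of 0] by (simp add: complex_of_real_integrable_eq)
  have "complex_of_real (integral\<^sup>L lborel v) = Gamma (of_real b + Complex \<sigma> 0)"
    using I(2)[of 0] by simp
  also have "of_real b + Complex \<sigma> 0 = of_real (\<sigma> + b)" by (simp add: complex_eq_iff)
  also have "Gamma (complex_of_real (\<sigma> + b)) = of_real (Gamma (\<sigma> + b))" by (rule Gamma_complex_of_real)
  finally have "integral\<^sup>L lborel v = Gamma (\<sigma> + b)" by (simp only: of_real_eq_iff)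
  then have "cf_of_density v (\<lambda>u. Gamma (of_real b + Complex \<sigma> u))"
    using iv I(2) Gamma_real_pos[OF assms] by (auto simp: cf_of_density_def v_def)
  then show ?thesis by blast
qed

text \<open>With \<open>a = c + s\<close> the quotient equals \<open>Beta a k / Gamma k\<close>, so
  its density is the Beta integrand divided by \<open>Gamma k\<close>. The total mass is exported
  because it bounds the quotient on the whole line.\<close>

lemma cf_of_density_Gamma_ratio:
  assumes "\<sigma> + c > 0" "k > 0"
  obtains v where "cf_of_density v (\<lambda>u. Gamma (of_real c + Complex \<sigma> u) * rGamma (of_real (c + k) + Complex \<sigma> u))"
    "integral\<^sup>L lborel v = Gamma (\<sigma> + c) * rGamma (\<sigma> + c + k)"
proof -
  define v where "v x = indicator {0<..<1} x * (x powr (\<sigma> + c - 1) * (1 - x) powr (k - 1)) * rGamma k" for x :: real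
  have eq: "complex_of_real (rGamma k) * (indicator {0<..<1} t *\<^sub>R (of_real t powr (of_real c + Complex \<sigma> u - 1) * of_real ((1 - t) powr (k - 1)))) =
       complex_of_real (v t) * cis (u * ln t)" for u t
  proof -
    have "of_real c + Complex \<sigma> u - 1 = Complex (\<sigma> + c - 1) u" by (simp add: complex_eq_iff)
    then show ?thesis
      by (simp add: v_def indicator_def powr_Complex_of_real)
  qed
  have re: "Re (of_real c + Complex \<sigma> u) > 0" for u using assms by simp
  have I1: "integrable lborel (\<lambda>x. complex_of_real (v x) * cis (u * ln x))" for u
    using integrable_mult_right[OF Beta_integrable_complex[OF re assms(2)], of "complex_of_real (rGamma k)"]
    unfolding eq .
  have rk: "rGamma k > 0" using assms by (simp add: rGamma_inverse_Gamma)
  have I2: "(LINT x|lborel. complex_of_real (v x) * cis (u * ln x)) =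
      Gamma (of_real c + Complex \<sigma> u) * rGamma (of_real (c + k) + Complex \<sigma> u)" for u
  proof -
    have "(LINT x|lborel. complex_of_real (v x) * cis (u * ln x)) = 
       complex_of_real (rGamma k) * Beta (of_real c + Complex \<sigma> u) (of_real k)"
      unfolding eq[symmetric] Beta_integral_complex[OF re assms(2), symmetric]
      by (rule integral_mult_right_zero)
    also have "\<dots> = (complex_of_real (rGamma k) * Gamma (of_real k)) * 
       (Gamma (of_real c + Complex \<sigma> u) * rGamma (of_real (c + k) + Complex \<sigma> u))"
      by (simp add: Beta_altdef algebra_simps)
    also have "complex_of_real (rGamma k) * Gamma (of_real k) = 1"
      using Gamma_real_pos[OF assms(2)] by (simp add: Gamma_complex_of_real rGamma_inverse_Gamma flip: of_real_mult)
    finally show ?thesis by simp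
  qed
  have iv: "integrable lborel v"
    using I1[of 0] by (simp add: complex_of_real_integrable_eq)
  have "complex_of_real (integral\<^sup>L lborel v) = Gamma (of_real c + Complex \<sigma> 0) * rGamma (of_real (c + k) + Complex \<sigma> 0)"
    using I2[of 0] by simp
  also have "of_real c + Complex \<sigma> 0 = of_real (\<sigma> + c)" by (simp add: complex_eq_iff)
  also have "of_real (c + k) + Complex \<sigma> 0 = of_real (\<sigma> + c + k)" by (simp add: complex_eq_iff)
  also have "Gamma (of_real (\<sigma> + c)) * rGamma (of_real (\<sigma> + c + k)) =
      complex_of_real (Gamma (\<sigma> + c) * rGamma (\<sigma> + c + k))"
    by (simp only: Gamma_complex_of_real rGamma_complex_of_real of_real_mult)
  finally have val: "integral\<^sup>L lborel v = Gamma (\<sigma> + c) * rGamma (\<sigma> + c + k)" by (simp only: of_real_eq_iff)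
  moreover have "Gamma (\<sigma> + c) * rGamma (\<sigma> + c + k) > 0"
    using assms by (simp add: rGamma_inverse_Gamma)
  ultimately have "cf_of_density v (\<lambda>u. Gamma (of_real c + Complex \<sigma> u) * rGamma (of_real (c + k) + Complex \<sigma> u))"
    using iv I2 rk by (auto simp: cf_of_density_def v_def)
  then show ?thesis using that val by blast
qed

text \<open>A characteristic function is bounded by the mass of its density, which is the value of
  the quotient at the real point of the line.\<close>

lemma norm_Gamma_ratio_le:
  assumes "Re w > 0" "k > 0"
  shows "norm (Gamma w * rGamma (w + of_real k)) \<le> Gamma (Re w) * rGamma (Re w + k)"
proof -
  obtain v where v: "cf_of_density v (\<lambda>u. Gamma (of_real 0 + Complex (Re w) u) * rGamma (of_real (0 + k) + Complex (Re w) u))"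
    "integral\<^sup>L lborel v = Gamma (Re w + 0) * rGamma (Re w + 0 + k)"
    using cf_of_density_Gamma_ratio[of "Re w" 0 k] assms by auto
  from v(1) have eq: "Gamma (of_real 0 + Complex (Re w) (Im w)) * rGamma (of_real (0 + k) + Complex (Re w) (Im w)) =
      (LINT x|lborel. of_real (v x) * cis (Im w * ln x))"
    unfolding cf_of_density_def by blast
  have "norm (LINT x|lborel. of_real (v x) * cis (Im w * ln x)) \<le> integral\<^sup>L lborel v"
    using integral_norm_bound[of lborel "\<lambda>x. of_real (v x) * cis (Im w * ln x)"] v(1)
    by (simp add: norm_mult cf_of_density_def)
  then show ?thesis
    unfolding eq[symmetric] v(2) by (simp add: add.commute)
qed

text \<open>As for Gamma itself, a shift by \<open>n\<close> leads to the right half-plane.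
  Numerator and denominator now both produce Pochhammer symbols, whose quotient has factors
  \<open>1 + k / (w + j)\<close>; each has modulus at most \<open>1 + k\<close>, because
  \<open>\<bar>Im w\<bar> \<ge> 1\<close>.\<close>

lemma Gamma_ratio_bounded_on_strip:
  fixes R k :: real
  assumes k: "k > 0"
  obtains C where "\<And>w. \<bar>Re w\<bar> \<le> R \<Longrightarrow> 1 \<le> \<bar>Im w\<bar> \<Longrightarrow> norm (Gamma w * rGamma (w + of_real k)) \<le> C"
proof -
  define n where "n = nat \<lceil>R\<rceil> + 2"
  have nR: "real n \<ge> R + 2" "n \<ge> 2"
    unfolding n_def by linarith+
  have "continuous_on {1..2 * real n} (\<lambda>x :: real. Gamma x * rGamma (x + k))"
    by (intro continuous_intros continuous_on_compose2[OF continuous_on_rGamma[of UNIV]])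
       (auto elim!: nonpos_Ints_cases)
  then have "bounded ((\<lambda>x :: real. Gamma x * rGamma (x + k)) ` {1..2 * real n})"
    by (intro compact_imp_bounded compact_continuous_image) auto
  then obtain C where C: "\<And>x. x \<in> {1..2 * real n} \<Longrightarrow> \<bar>Gamma x * rGamma (x + k)\<bar> \<le> C"
    unfolding bounded_iff by (metis imageI real_norm_def)
  have "norm (Gamma w * rGamma (w + of_real k)) \<le> C * (1 + k) ^ n" if "\<bar>Re w\<bar> \<le> R" "1 \<le> \<bar>Im w\<bar>" for w
  proof -
    have w: "w \<notin> \<int>\<^sub>\<le>\<^sub>0" "w + of_nat n \<notin> \<int>\<^sub>\<le>\<^sub>0"
      using that by (auto intro!: not_nonpos_Int_complex)
    have big: "1 \<le> norm (w + of_nat j)" for j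
      using abs_Im_le_cmod[of "w + of_nat j"] that by simp
    then have nz: "w + of_nat j \<noteq> 0" for j
      by (metis norm_zero not_one_le_zero)
    have "rGamma w = pochhammer w n * rGamma (w + of_nat n)" by (rule pochhammer_rGamma)
    then have "Gamma w = Gamma (w + of_nat n) / pochhammer w n"
      by (simp add: Gamma_def field_simps)
    moreover have "rGamma (w + of_real k) = pochhammer (w + of_real k) n * rGamma (w + of_nat n + of_real k)"
      using pochhammer_rGamma[of "w + of_real k" n] by (simp add: algebra_simps)
    ultimately have "Gamma w * rGamma (w + of_real k) = 
        Gamma (w + of_nat n) * rGamma (w + of_nat n + of_real k) * (\<Prod>j<n. (w + of_real k + of_nat j) / (w + of_nat j))"
      by (simp add: pochhammer_prod prod_dividef atLeast0LessThan)
    then have "norm (Gamma w * rGamma (w + of_real k)) = 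
       norm (Gamma (w + of_nat n) * rGamma (w + of_nat n + of_real k)) * 
         (\<Prod>j<n. norm ((w + of_real k + of_nat j) / (w + of_nat j)))"
      by (simp only: norm_mult prod_norm)
    also have "\<dots> \<le> C * (\<Prod>j<n. 1 + k)"
    proof (intro mult_mono prod_mono conjI prod_nonneg)
      have "norm (Gamma (w + of_nat n) * rGamma (w + of_nat n + of_real k)) \<le>
          Gamma (Re (w + of_nat n)) * rGamma (Re (w + of_nat n) + k)"
        using that nR k by (intro norm_Gamma_ratio_le) auto
      also have "\<dots> \<le> C" using C[of "Re (w + of_nat n)"] that nR by force
      finally show "norm (Gamma (w + of_nat n) * rGamma (w + of_nat n + of_real k)) \<le> C" .
      then show "0 \<le> C" using norm_ge_zero order.trans by blast
      fix j
      have "(w + of_real k + of_nat j) / (w + of_nat j) = 1 + of_real k / (w + of_nat j)"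
        using nz[of j] by (simp add: field_simps)
      then have "norm ((w + of_real k + of_nat j) / (w + of_nat j)) \<le> 1 + norm (of_real k / (w + of_nat j))"
        using norm_triangle_ineq[of 1 "of_real k / (w + of_nat j)"] by simp
      also have "\<dots> \<le> 1 + k"
        using big[of j] k nz[of j] mult_left_mono[OF big[of j], of k] by (simp add: norm_divide divide_le_eq)
      finally show "norm ((w + of_real k + of_nat j) / (w + of_nat j)) \<le> 1 + k" .
    qed auto
    finally show ?thesis by simp
  qed
  then show thesis by (rule that)
qed

section \<open>Mellin inversion for Gamma\<close>

lemma integrable_inverse_1_plus_square: "integrable lborel (\<lambda>x :: real. inverse (1 + x\<^sup>2))"
proof -
  have nz: "1 + x\<^sup>2 \<noteq> 0" for x :: real
    by (metis add_nonneg_eq_0_iff zero_le_one zero_le_power2 zero_neq_one)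
  have "set_integrable lborel (einterval (-\<infinity>) \<infinity>) (\<lambda>x :: real. inverse (1 + x\<^sup>2))"
  proof (rule interval_integral_FTC_nonneg(1))
    show "((arctan \<circ> real_of_ereal) \<longlongrightarrow> - (pi / 2)) (at_right (- \<infinity>))"
      unfolding ereal_tendsto_simps1 by (rule tendsto_arctan_at_bot)
    show "((arctan \<circ> real_of_ereal) \<longlongrightarrow> pi / 2) (at_left \<infinity>)"
      unfolding ereal_tendsto_simps1 by (rule tendsto_arctan_at_top)
    show "DERIV arctan x :> inverse (1 + x\<^sup>2)" for x by (rule DERIV_arctan)
    show "isCont (\<lambda>x. inverse (1 + x\<^sup>2)) x" for x :: real
      using nz by (intro continuous_intros) auto
  qed auto
  then show ?thesis by (simp add: set_integrable_def)
qed

lemma integrable_inverse_square_decay: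
  fixes f :: "real \<Rightarrow> complex"
  assumes "continuous_on UNIV f" and C: "\<And>u. 1 \<le> \<bar>u\<bar> \<Longrightarrow> norm (f u) \<le> C / u\<^sup>2"
  shows "integrable lborel f"
proof -
  have "bounded (f ` {-1..1})"
    using assms(1) by (intro compact_imp_bounded compact_continuous_image) (auto intro: continuous_on_subset)
  then obtain B where B: "\<And>u. u \<in> {-1..1} \<Longrightarrow> norm (f u) \<le> B"
    unfolding bounded_iff by (metis imageI)
  have B0: "B \<ge> 0" using B[of 0] by (auto intro: order.trans[OF norm_ge_zero])
  have C0: "C \<ge> 0" using C[of 1] by (auto intro: order.trans[OF norm_ge_zero])
  have [measurable]: "f \<in> borel_measurable borel"
    using assms(1) by (rule borel_measurable_continuous_onI)
  show ?thesis
  proof (rule Bochner_Integration.integrable_bound)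
    \<comment> \<open>\<open>1 + u\<^sup>2\<close> is at most 2 on \<open>[-1, 1]\<close> and at
      most \<open>2 * u\<^sup>2\<close> outside, which accounts for the two factors 2.\<close>
    show "integrable lborel (\<lambda>u :: real. (2 * B + 2 * C) * inverse (1 + u\<^sup>2))"
      using integrable_inverse_1_plus_square by simp
    show "AE u in lborel. norm (f u) \<le> norm ((2 * B + 2 * C) * inverse (1 + u\<^sup>2))"
    proof (rule AE_I2)
      fix u :: real
      have pos: "1 + u\<^sup>2 > 0" by (simp add: add_pos_nonneg)
      have "norm (f u) \<le> (2 * B + 2 * C) / (1 + u\<^sup>2)"
      proof (cases "1 \<le> \<bar>u\<bar>")
        case True
        then have u: "1 \<le> u\<^sup>2" using one_le_power[of "\<bar>u\<bar>" 2] by simp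
        have "norm (f u) \<le> C / u\<^sup>2" using C True by blast
        also have "\<dots> \<le> (2 * C) / (1 + u\<^sup>2)"
          unfolding pos_le_divide_eq[OF pos] times_divide_eq_left
          using u True C0 mult_left_mono[OF u, of C] by (subst pos_divide_le_eq) (auto simp: algebra_simps)
        also have "\<dots> \<le> (2 * B + 2 * C) / (1 + u\<^sup>2)"
          using B0 pos by (intro divide_right_mono) auto
        finally show ?thesis .
      next
        case False
        then have u: "u\<^sup>2 \<le> 1" by (simp add: abs_square_le_1)
        have "u \<in> {-1..1}" using False by (simp add: not_le abs_less_iff)
        then have "norm (f u) \<le> B" by (rule B)
        also have "\<dots> \<le> (2 * B + 2 * C) / (1 + u\<^sup>2)"
          using u B0 C0 pos mult_left_mono[OF u, of B] by (simp add: field_simps)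
        finally show ?thesis .
      qed
      then show "norm (f u) \<le> norm ((2 * B + 2 * C) * inverse (1 + u\<^sup>2))"
        using B0 C0 pos by (simp add: divide_inverse abs_mult)
    qed
  qed auto
qed

text \<open>Any exhausting family of intervals is allowed; this matters for a truncated contour,
  whose two end points lie at unrelated heights.\<close>

lemma has_integral_UNIV_tendsto:
  fixes f :: "real \<Rightarrow> 'a :: banach"
  assumes "(f has_integral I) UNIV" "filterlim a at_bot F" "filterlim b at_top F"
  shows "((\<lambda>n. integral {a n..b n} f) \<longlongrightarrow> I) F"
proof (rule tendstoI)
  fix e :: real assume "e > 0"
  then obtain B where B: "\<And>a b. ball 0 B \<subseteq> {a..b} \<Longrightarrow> norm (integral {a..b} f - I) < e"
    using assms(1) unfolding has_integral_alt'[of f I UNIV] by (simp, blast)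
  have "eventually (\<lambda>n. a n \<le> - B) F" "eventually (\<lambda>n. b n \<ge> B) F"
    using assms(2,3) by (auto simp: filterlim_at_bot filterlim_at_top)
  then show "eventually (\<lambda>n. dist (integral {a n..b n} f) I < e) F"
  proof eventually_elim
    case (elim n)
    then have "ball 0 B \<subseteq> {a n..b n}" by (auto simp: dist_real_def)
    from B[OF this] show ?case by (simp add: dist_norm)
  qed
qed

lemma continuous_on_Gamma_vertical:
  assumes "complex_of_real \<sigma> \<notin> \<int>\<^sub>\<le>\<^sub>0"
  shows "continuous_on UNIV (\<lambda>u. Gamma (Complex \<sigma> u))"
proof -
  have "Gamma holomorphic_on (- \<int>\<^sub>\<le>\<^sub>0 :: complex set)" by (intro holomorphic_intros) auto
  moreover have "Complex \<sigma> u \<notin> \<int>\<^sub>\<le>\<^sub>0" for u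
    using assms not_nonpos_Int_complex[of "Complex \<sigma> u"] by (cases "u = 0") (auto simp: complex_of_real_def)
  moreover have "continuous_on UNIV (Complex \<sigma>)" unfolding Complex_eq by (intro continuous_intros)
  ultimately show ?thesis
    using continuous_on_compose2[of "- \<int>\<^sub>\<le>\<^sub>0" Gamma UNIV "Complex \<sigma>"]
    by (auto dest: holomorphic_on_imp_continuous_on)
qed

lemma integrable_Gamma_vertical:
  assumes "complex_of_real \<sigma> \<notin> \<int>\<^sub>\<le>\<^sub>0"
  shows "integrable lborel (\<lambda>u. Gamma (Complex \<sigma> u))"
proof -
  obtain C where C: "\<And>w. \<bar>Re w\<bar> \<le> \<bar>\<sigma>\<bar> \<Longrightarrow> 1 \<le> \<bar>Im w\<bar> \<Longrightarrow> norm (Gamma w) \<le> C / (Im w)\<^sup>2"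
    using Gamma_decay_on_strip by blast
  show ?thesis
    by (rule integrable_inverse_square_decay[OF continuous_on_Gamma_vertical[OF assms]])
       (use C[of "Complex \<sigma> _"] in simp)
qed

text \<open>Residue theorem on tall rectangles between \<open>Re w = \<epsilon>\<close> and a
  half-integer abscissa, which passes between two poles. The poles enclosed are
  \<open>0, -1, ..., -N\<close>, and the residue at \<open>-n\<close> is \<open>(-1)^n / n!\<close>
  times \<open>exp (n * L)\<close>. The horizontal sides vanish by the quadratic decay.\<close>

lemma Gamma_Mellin_rectangle:
  fixes L \<epsilon> :: real and N :: nat
  assumes "\<epsilon> > 0"
  defines "f \<equiv> \<lambda>w. Gamma w * exp (- (w * of_real L))"
  defines "x \<equiv> - (real N + 1 / 2)"
  shows "(LINT u|lborel. f (Complex \<epsilon> u)) =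
     (LINT u|lborel. f (Complex x u)) + 2 * of_real pi * (\<Sum>n\<le>N. (- of_real (exp L)) ^ n / fact n)"
proof -
  define S where "S = (\<Sum>n\<le>N. (- of_real (exp L)) ^ n / fact n :: complex)"
  define R where "R = max \<epsilon> (real N + 1 / 2)"
  obtain C where C: "C \<ge> 0" "\<And>w. \<bar>Re w\<bar> \<le> R \<Longrightarrow> 1 \<le> \<bar>Im w\<bar> \<Longrightarrow> norm (Gamma w) \<le> C / (Im w)\<^sup>2"
    using Gamma_decay_on_strip by blast
  have xR: "\<bar>x\<bar> \<le> R" "\<bar>\<epsilon>\<bar> \<le> R" "x < 0" using assms(1) by (auto simp: x_def R_def)
  have xni: "complex_of_real x \<notin> \<int>\<^sub>\<le>\<^sub>0"
  proof
    assume "complex_of_real x \<in> \<int>\<^sub>\<le>\<^sub>0"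
    then obtain n where "complex_of_real x = - of_nat n" by (elim nonpos_Ints_cases')
    then have "complex_of_real x = of_real (- real n)" by simp
    then have "x = - real n" by (simp only: of_real_eq_iff)
    then have "2 * n = 2 * N + 1" by (simp add: x_def field_simps)
    then show False by presburger
  qed
  have bound: "norm (f w) \<le> C * exp (R * \<bar>L\<bar>) / (Im w)\<^sup>2" if "\<bar>Re w\<bar> \<le> R" "1 \<le> \<bar>Im w\<bar>" for w
  proof -
    have "- (Re w * L) \<le> \<bar>Re w\<bar> * \<bar>L\<bar>" by (metis abs_ge_minus_self abs_mult)
    also have "\<dots> \<le> R * \<bar>L\<bar>" using that by (intro mult_right_mono) auto
    finally have "norm (exp (- (w * of_real L))) \<le> exp (R * \<bar>L\<bar>)" by simp
    then have "norm (f w) \<le> (C / (Im w)\<^sup>2) * exp (R * \<bar>L\<bar>)"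
      unfolding f_def norm_mult using C(2)[OF that] by (intro mult_mono) (auto intro: order.trans[OF norm_ge_zero])
    then show ?thesis by (simp add: mult_ac)
  qed
  have cont: "continuous_on UNIV (\<lambda>u. f (Complex \<sigma> u))" if "complex_of_real \<sigma> \<notin> \<int>\<^sub>\<le>\<^sub>0" for \<sigma>
    unfolding f_def Complex_eq
    by (intro continuous_intros continuous_on_Gamma_vertical[OF that, unfolded Complex_eq])
  have eni: "complex_of_real \<epsilon> \<notin> \<int>\<^sub>\<le>\<^sub>0" using assms(1) by (intro not_nonpos_Int_complex) auto
  have int: "integrable lborel (\<lambda>u. f (Complex \<epsilon> u))" "integrable lborel (\<lambda>u. f (Complex x u))"
    by (intro integrable_inverse_square_decay[of _ "C * exp (R * \<bar>L\<bar>)"] cont eni xni; use bound[of "Complex _ _"] xR in force)+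
  let ?H = "\<lambda>T. contour_integral (linepath (Complex x T) (Complex \<epsilon> T)) f"
  have rect: "?H (- T) + \<i> * integral {-T..T} (\<lambda>u. f (Complex \<epsilon> u)) - ?H T - \<i> * integral {-T..T} (\<lambda>u. f (Complex x u)) =
      2 * of_real pi * \<i> * S" if T: "T \<ge> 1" for T
  proof -
    \<comment> \<open>This half-plane contains the rectangle and no pole beyond \<open>-N\<close>;
      its convexity makes the winding numbers around all points outside it vanish.\<close>
    define A where "A = {w. Re w > - (real N + 1)}"
    define pts where "pts = (\<lambda>n. - of_nat n :: complex) ` {..N}"
    let ?p = "rectpath (Complex x (- T)) (Complex \<epsilon> T)"
    have im: "path_image ?p \<subseteq> A - \<int>\<^sub>\<le>\<^sub>0"
    proof
      fix w assume "w \<in> path_image ?p"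
      then have w: "Re w \<in> {x..\<epsilon>}" "Re w = x \<or> Re w = \<epsilon> \<or> Im w = -T \<or> Im w = T"
        using xR assms(1) T path_image_rectpath[of "Complex x (- T)" "Complex \<epsilon> T"] by auto
      have "w \<notin> \<int>\<^sub>\<le>\<^sub>0"
      proof
        assume wn: "w \<in> \<int>\<^sub>\<le>\<^sub>0"
        then have "w = of_real (Re w)" by (auto elim!: nonpos_Ints_cases)
        then show False using w wn xni not_nonpos_Int_complex[of w] T assms(1) by auto
      qed
      then show "w \<in> A - \<int>\<^sub>\<le>\<^sub>0" using w by (auto simp: A_def x_def)
    qed
    have holo: "f holomorphic_on (A - pts)"
    proof -
      have "A - pts \<subseteq> - \<int>\<^sub>\<le>\<^sub>0"
      proof
        fix w assume w: "w \<in> A - pts"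
        show "w \<in> - \<int>\<^sub>\<le>\<^sub>0"
        proof
          assume "w \<in> \<int>\<^sub>\<le>\<^sub>0"
          then obtain n where n: "w = - of_nat n" by (elim nonpos_Ints_cases')
          then have "real n < real N + 1" using w by (simp add: A_def)
          then have "n \<le> N" by linarith
          with n w show False by (auto simp: pts_def)
        qed
      qed
      then show ?thesis
        unfolding f_def by (intro holomorphic_intros) auto
    qed
    have ptsni: "pts \<subseteq> \<int>\<^sub>\<le>\<^sub>0" by (auto simp: pts_def)
    have "contour_integral ?p f = 2 * pi * \<i> * (\<Sum>p\<in>pts. winding_number ?p p * residue f p)"
    proof (rule Residue_theorem[of A])
      show "open A" unfolding A_def by (rule open_halfspace_Re_gt)
      have cA: "convex A" unfolding A_def by (rule convex_halfspace_Re_gt)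
      then show "connected A" by (rule convex_connected)
      show "path_image ?p \<subseteq> A - pts" using im ptsni by auto
      show "\<forall>z. z \<notin> A \<longrightarrow> winding_number ?p z = 0"
        using winding_number_zero_outside[OF _ cA, of ?p] im by auto
    qed (use holo in \<open>auto simp: pts_def\<close>)
    also have "(\<Sum>p\<in>pts. winding_number ?p p * residue f p) = S"
    proof -
      have "(\<Sum>p\<in>pts. winding_number ?p p * residue f p) = (\<Sum>n\<le>N. winding_number ?p (- of_nat n) * residue f (- of_nat n))"
        unfolding pts_def by (subst sum.reindex) (auto simp: inj_on_def)
      also have "\<dots> = S"
        unfolding S_def
      proof (rule sum.cong[OF refl])
        fix n assume n: "n \<in> {..N}"
        have "winding_number ?p (- of_nat n) = 1"
          using n T assms(1) by (intro winding_number_rectpath) (auto simp: in_box_complex_iff x_def)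
        moreover have "residue f (- of_nat n) = (- of_real (exp L)) ^ n / fact n"
        proof (rule residue_simple')
          \<comment> \<open>All other poles are removed from the domain, so \<open>-n\<close> is the
            only singularity left in it.\<close>
          show "open (- (\<int>\<^sub>\<le>\<^sub>0 - {-of_nat n}) :: complex set)"
            by (intro open_Compl closed_subset_Ints) auto
          show "f holomorphic_on (- (\<int>\<^sub>\<le>\<^sub>0 - {-of_nat n}) - {- of_nat n})"
            unfolding f_def by (intro holomorphic_intros) auto
          have "((\<lambda>w. Gamma w * (w + of_nat n) * exp (- (w * of_real L))) \<longlongrightarrow>
             (- 1) ^ n / fact n * exp (- (- of_nat n * of_real L))) (at (- of_nat n))"
            by (intro tendsto_intros Gamma_residues)
          also have "(- 1) ^ n / fact n * exp (- (- of_nat n * complex_of_real L)) = (- of_real (exp L)) ^ n / fact n"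
            by (simp add: exp_of_nat_mult exp_of_real power_minus[of "of_real (exp L)" n])
          finally show "((\<lambda>w. f w * (w - - of_nat n)) \<longlongrightarrow> (- of_real (exp L)) ^ n / fact n) (at (- of_nat n))"
            by (simp add: f_def mult_ac)
        qed auto
        ultimately show "winding_number ?p (- of_nat n) * residue f (- of_nat n) = (- of_real (exp L)) ^ n / fact n"
          by simp
      qed
      finally show ?thesis .
    qed
    finally have res: "contour_integral ?p f = 2 * pi * \<i> * S" .
    have conta: "continuous_on (path_image ?p) f"
    proof -
      have "f holomorphic_on (- \<int>\<^sub>\<le>\<^sub>0)" unfolding f_def by (intro holomorphic_intros) auto
      then show ?thesis using im by (meson Compl_iff Diff_iff continuous_on_subset holomorphic_on_imp_continuous_on subset_iff)
    qed
    let ?a1 = "Complex x (- T)" and ?a2 = "Complex \<epsilon> (- T)" and ?a3 = "Complex \<epsilon> T" and ?a4 = "Complex x T"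
    have rp: "?p = linepath ?a1 ?a2 +++ linepath ?a2 ?a3 +++ linepath ?a3 ?a4 +++ linepath ?a4 ?a1"
      by (simp add: rectpath_def Let_def)
    have seg: "f contour_integrable_on linepath ?a1 ?a2" "f contour_integrable_on linepath ?a2 ?a3"
       "f contour_integrable_on linepath ?a3 ?a4" "f contour_integrable_on linepath ?a4 ?a1"
      by (auto intro!: contour_integrable_continuous_linepath continuous_on_subset[OF conta] simp: rp path_image_join)
    have "contour_integral ?p f = contour_integral (linepath ?a1 ?a2) f + contour_integral (linepath ?a2 ?a3) f +
       contour_integral (linepath ?a3 ?a4) f + contour_integral (linepath ?a4 ?a1) f"
      unfolding rp using seg by (simp add: contour_integrable_join)
    moreover have "contour_integral (linepath ?a3 ?a4) f = - ?H T"
      using contour_integral_reversepath[of "linepath ?a4 ?a3" f] by simp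
    moreover have "contour_integral (linepath ?a4 ?a1) f = - (\<i> * integral {-T..T} (\<lambda>u. f (Complex x u)))"
      using contour_integral_reversepath[of "linepath ?a1 ?a4" f] T
      by (simp add: contour_integral_linepath_same_Re[of ?a1 x ?a4 "-T" T])
    moreover have "contour_integral (linepath ?a2 ?a3) f = \<i> * integral {-T..T} (\<lambda>u. f (Complex \<epsilon> u))"
      using T by (simp add: contour_integral_linepath_same_Re[of ?a2 \<epsilon> ?a3 "-T" T])
    ultimately show ?thesis using res by simp
  qed
  have H: "norm (?H s) \<le> C * exp (R * \<bar>L\<bar>) / T\<^sup>2 * (\<epsilon> - x)" if "T \<ge> 1" "\<bar>s\<bar> = T" for s T
  proof -
    have s2: "s\<^sup>2 = T\<^sup>2" using that(2) by (metis power2_abs)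
    have "norm (?H s) \<le> C * exp (R * \<bar>L\<bar>) / T\<^sup>2 * norm (Complex \<epsilon> s - Complex x s)"
    proof (rule contour_integral_bound_linepath)
      have "f contour_integrable_on linepath (Complex x s) (Complex \<epsilon> s)"
      proof (rule contour_integrable_continuous_linepath)
        have "w \<notin> \<int>\<^sub>\<le>\<^sub>0" if "w \<in> closed_segment (Complex x s) (Complex \<epsilon> s)" for w
          using that \<open>\<bar>s\<bar> = T\<close> \<open>T \<ge> 1\<close>
          by (intro not_nonpos_Int_complex) (auto simp: closed_segment_same_Im)
        then show "continuous_on (closed_segment (Complex x s) (Complex \<epsilon> s)) f"
          unfolding f_def by (intro continuous_intros) auto
      qed
      then show "f contour_integrable_on linepath (Complex x s) (Complex \<epsilon> s)" .
      fix w assume w: "w \<in> closed_segment (Complex x s) (Complex \<epsilon> s)"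
      have "closed_segment (Complex x s) (Complex \<epsilon> s) = {z. Im z = s \<and> Re z \<in> {x..\<epsilon>}}"
        using xR(3) assms(1) by (subst closed_segment_same_Im) (simp_all add: closed_segment_eq_real_ivl1)
      with w have "Im w = s" "x \<le> Re w" "Re w \<le> \<epsilon>" by auto
      then have "\<bar>Re w\<bar> \<le> R" "1 \<le> \<bar>Im w\<bar>" using xR that by linarith+
      moreover have "(Im w)\<^sup>2 = T\<^sup>2" using s2 \<open>Im w = s\<close> by simp
      ultimately show "norm (f w) \<le> C * exp (R * \<bar>L\<bar>) / T\<^sup>2"
        using bound[of w] by simp
    qed (use C in auto)
    also have "norm (Complex \<epsilon> s - Complex x s) = \<epsilon> - x"
      using xR assms(1) by (simp add: cmod_def)
    finally show ?thesis .
  qed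
  have decay: "((\<lambda>T. C * exp (R * \<bar>L\<bar>) / T\<^sup>2 * (\<epsilon> - x)) \<longlongrightarrow> 0) at_top"
    by real_asymp
  have H0: "((\<lambda>T. ?H (- T)) \<longlongrightarrow> 0) at_top" "((\<lambda>T. ?H T) \<longlongrightarrow> 0) at_top"
    by (rule Lim_null_comparison[OF _ decay]; rule eventually_mono[OF eventually_ge_at_top[of 1]]; rule H; simp)+
  have lim: "((\<lambda>T. integral {-T..T} (\<lambda>u. f (Complex \<sigma> u))) \<longlongrightarrow> (LINT u|lborel. f (Complex \<sigma> u))) at_top"
    if "integrable lborel (\<lambda>u. f (Complex \<sigma> u))" for \<sigma>
    by (intro has_integral_UNIV_tendsto has_integral_integral_lborel that filterlim_ident filterlim_uminus_at_bot_at_top)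
  have "((\<lambda>T. ?H (- T) + \<i> * integral {-T..T} (\<lambda>u. f (Complex \<epsilon> u)) - ?H T - \<i> * integral {-T..T} (\<lambda>u. f (Complex x u)))
     \<longlongrightarrow> 0 + \<i> * (LINT u|lborel. f (Complex \<epsilon> u)) - 0 - \<i> * (LINT u|lborel. f (Complex x u))) at_top"
    by (intro tendsto_intros H0 lim int)
  moreover have "((\<lambda>T. ?H (- T) + \<i> * integral {-T..T} (\<lambda>u. f (Complex \<epsilon> u)) - ?H T - \<i> * integral {-T..T} (\<lambda>u. f (Complex x u)))
     \<longlongrightarrow> 2 * of_real pi * \<i> * S) at_top"
    by (rule tendsto_eventually, rule eventually_mono[OF eventually_ge_at_top[of 1]]) (rule rect)
  ultimately have "0 + \<i> * (LINT u|lborel. f (Complex \<epsilon> u)) - 0 - \<i> * (LINT u|lborel. f (Complex x u)) = 2 * of_real pi * \<i> * S"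
    by (rule tendsto_unique[rotated]) simp
  then have "\<i> * (LINT u|lborel. f (Complex \<epsilon> u)) = \<i> * ((LINT u|lborel. f (Complex x u)) + 2 * of_real pi * S)"
    by (simp add: algebra_simps)
  then show ?thesis unfolding S_def by simp
qed

text \<open>The term \<open>j = 0\<close> contributes the \<open>1 / 2\<close>, and every later term
  exceeds \<open>j\<close>.\<close>

lemma prod_half_odd_ge_fact: "fact N / 2 \<le> (\<Prod>j<Suc N. real j + 1 / 2)"
proof (induction N)
  case (Suc N)
  have "fact (Suc N) / 2 = (fact N / 2) * (real N + 1)" by (simp add: field_simps)
  also have "\<dots> \<le> (\<Prod>j<Suc N. real j + 1 / 2) * (real (Suc N) + 1 / 2)"
    using Suc by (intro mult_mono) (auto intro!: mult_nonneg_nonneg prod_nonneg)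
  finally show ?case by simp
qed simp

text \<open>\<open>N + 1\<close> applications of the functional equation lead from this line to
  \<open>Re w = 1 / 2\<close>. The divisors are bounded below by their real parts, whose product
  grows like a factorial uniformly in \<open>u\<close>.\<close>

lemma norm_Gamma_shifted_le:
  "norm (Gamma (Complex (- (real N + 1 / 2)) u)) \<le> 2 / fact N * norm (Gamma (Complex (1 / 2) u))"
proof -
  let ?z = "Complex (- (real N + 1 / 2)) u"
  have "fact N / 2 \<le> (\<Prod>j<Suc N. real j + 1 / 2)" by (rule prod_half_odd_ge_fact)
  \<comment> \<open>The \<open>j\<close>-th divisor has real part \<open>- (N - j + 1/2)\<close>, so
    the half-odd numbers occur in reversed order.\<close>
  also have "\<dots> = (\<Prod>j<Suc N. real (Suc N - Suc j) + 1 / 2)"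
    by (rule prod.nat_diff_reindex[symmetric])
  also have "\<dots> \<le> (\<Prod>j<Suc N. norm (?z + of_nat j))"
  proof (intro prod_mono conjI)
    fix j assume "j \<in> {..<Suc N}"
    then show "real (Suc N - Suc j) + 1 / 2 \<le> norm (?z + of_nat j)"
      using abs_Re_le_cmod[of "?z + of_nat j"] by (simp add: of_nat_diff)
  qed simp
  also have "\<dots> = norm (pochhammer ?z (Suc N))"
    by (simp only: pochhammer_prod prod_norm atLeast0LessThan)
  finally have p: "fact N / 2 \<le> norm (pochhammer ?z (Suc N))" .
  have "rGamma ?z = pochhammer ?z (Suc N) * rGamma (?z + of_nat (Suc N))" by (rule pochhammer_rGamma)
  moreover have "?z + of_nat (Suc N) = Complex (1 / 2) u" by (simp add: complex_eq_iff)
  ultimately have "Gamma ?z = Gamma (Complex (1 / 2) u) / pochhammer ?z (Suc N)"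
    by (simp add: Gamma_def field_simps)
  then have "norm (Gamma ?z) = norm (Gamma (Complex (1 / 2) u)) / norm (pochhammer ?z (Suc N))"
    by (simp only: norm_divide)
  also have "\<dots> \<le> norm (Gamma (Complex (1 / 2) u)) / (fact N / 2)"
  proof (rule divide_left_mono[OF p])
    have fp: "0 < (fact N / 2 :: real)" by simp
    show "0 < norm (pochhammer ?z (Suc N)) * (fact N / 2)"
      using less_le_trans[OF fp p] fp by (rule mult_pos_pos)
  qed simp
  finally show ?thesis by (simp add: field_simps)
qed

text \<open>For \<open>x = exp L\<close> this is the inversion formula for \<open>exp (- x)\<close>.
  As \<open>N\<close> grows the residues sum to its power series, while the remaining line integral
  is at most a constant times \<open>x^N / N!\<close>.\<close>

theorem Gamma_Mellin_inversion:
  fixes L \<epsilon> :: real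
  assumes "\<epsilon> > 0"
  shows "(LINT u|lborel. Gamma (Complex \<epsilon> u) * exp (- (Complex \<epsilon> u * of_real L))) = of_real (2 * pi * exp (- exp L))"
proof -
  define J where "J \<sigma> = (LINT u|lborel. Gamma (Complex \<sigma> u) * exp (- (Complex \<sigma> u * of_real L)))" for \<sigma>
  define G where "G = (LINT u|lborel. norm (Gamma (Complex (1 / 2) u)))"
  have half: "complex_of_real (1 / 2) \<notin> \<int>\<^sub>\<le>\<^sub>0" by (rule not_nonpos_Int_complex) simp
  have J: "J \<epsilon> = J (- (real N + 1 / 2)) + 2 * of_real pi * (\<Sum>n\<le>N. (- of_real (exp L)) ^ n / fact n)" for N
    unfolding J_def by (rule Gamma_Mellin_rectangle[OF assms])
  have bd: "norm (J (- (real N + 1 / 2))) \<le> 2 * G * exp (L / 2) * ((exp L) ^ N / fact N)" for N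
  proof -
    let ?x = "- (real N + 1 / 2)"
    have "norm (J ?x) \<le> (LINT u|lborel. (2 * exp (L / 2) * ((exp L) ^ N / fact N)) * norm (Gamma (Complex (1 / 2) u)))"
      unfolding J_def
    proof (rule order.trans[OF integral_norm_bound integral_mono'])
      show "integrable lborel (\<lambda>u. (2 * exp (L / 2) * ((exp L) ^ N / fact N)) * norm (Gamma (Complex (1 / 2) u)))"
        using integrable_Gamma_vertical[OF half] by simp
      have e: "norm (exp (- (Complex ?x u * of_real L))) = exp L ^ N * exp (L / 2)" for u
        by (simp add: exp_of_nat_mult[symmetric] exp_add[symmetric] algebra_simps)
      show "norm (Gamma (Complex ?x u) * exp (- (Complex ?x u * of_real L))) \<le>
         (2 * exp (L / 2) * ((exp L) ^ N / fact N)) * norm (Gamma (Complex (1 / 2) u))" for u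
        using mult_right_mono[OF norm_Gamma_shifted_le[of N u], of "exp L ^ N * exp (L / 2)"]
        unfolding norm_mult e by (simp add: mult_ac)
    qed simp
    then show ?thesis by (simp add: G_def mult_ac)
  qed
  have "(\<lambda>N. exp L ^ N / fact N) \<longlonglongrightarrow> 0"
    using summable_LIMSEQ_zero[OF summable_exp[of "exp L"]] by (simp only: divide_inverse mult.commute)
  then have lim: "(\<lambda>N. 2 * G * exp (L / 2) * (exp L ^ N / fact N)) \<longlonglongrightarrow> 0"
    by (rule tendsto_mult_right_zero)
  have "(\<lambda>N. J (- (real N + 1 / 2))) \<longlonglongrightarrow> 0"
    by (rule Lim_null_comparison[OF _ lim], rule always_eventually, rule allI, rule bd)
  moreover have "(\<lambda>N. \<Sum>n\<le>N. (- complex_of_real (exp L)) ^ n / fact n) \<longlonglongrightarrow> exp (- of_real (exp L))"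
  proof -
    have "x ^ n /\<^sub>R fact n = x ^ n / fact n" for x :: complex and n
      by (simp add: scaleR_conv_of_real divide_inverse)
    then show ?thesis
      using exp_converges[of "- complex_of_real (exp L)"] by (simp only: sums_def_le)
  qed
  ultimately have "(\<lambda>N. J (- (real N + 1 / 2)) + 2 * of_real pi * (\<Sum>n\<le>N. (- of_real (exp L)) ^ n / fact n))
      \<longlonglongrightarrow> 0 + 2 * of_real pi * exp (- of_real (exp L))"
    by (intro tendsto_intros)
  then have "(\<lambda>N :: nat. J \<epsilon>) \<longlonglongrightarrow> 0 + 2 * of_real pi * exp (- of_real (exp L))"
    unfolding J[symmetric] .
  then have "J \<epsilon> = 2 * of_real pi * exp (- of_real (exp L))"
    by (simp add: LIMSEQ_const_iff)
  moreover have "exp (- of_real (exp L)) = complex_of_real (exp (- exp L))"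
    using exp_of_real[of "- exp L", where ?'a = complex] by (simp only: of_real_minus)
  ultimately show ?thesis
    by (simp only: J_def of_real_mult of_real_numeral)
qed

section \<open>Independence of the contour\<close>

text \<open>The two paths close up to a loop whose winding number is the difference of theirs. The
  unbounded connected set \<open>T\<close> puts \<open>w\<close> outside this loop.\<close>

lemma winding_number_eq_connected:
  assumes p: "path p" and q: "path q" "pathstart q = pathstart p" "pathfinish q = pathfinish p"
    and T: "connected T" "\<not> bounded T" "w \<in> T" "T \<inter> path_image p = {}" "T \<inter> path_image q = {}"
  shows "winding_number p w = winding_number q w"
proof -
  let ?c = "p +++ reversepath q"
  have "T \<subseteq> connected_component_set (- path_image ?c) w"
    using T q by (intro connected_component_maximal) (auto simp: path_image_join)
  then have "\<not> bounded (connected_component_set (- path_image ?c) w)"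
    using T(2) bounded_subset by blast
  then have "w \<in> outside (path_image ?c)"
    using T q by (auto simp: outside_def path_image_join)
  then have "winding_number ?c w = 0"
    using p q by (intro winding_number_zero_in_outside) auto
  moreover have "w \<notin> path_image p" "w \<notin> path_image q"
    using T by auto
  ultimately show ?thesis
    using p q by (simp add: winding_number_join winding_number_reversepath)
qed

text \<open>The sign \<open>\<kappa>\<close>, always \<open>1\<close> or \<open>-1\<close>, selects
  the right or the left ray from \<open>y\<close>, so that poles on either side of the contour are
  handled by one argument.\<close>

definition real_ray :: "real \<Rightarrow> real \<Rightarrow> complex set" where
  "real_ray \<kappa> y = complex_of_real ` {x. \<kappa> * y \<le> \<kappa> * x}"

lemma in_real_ray_iff: "z \<in> real_ray \<kappa> y \<longleftrightarrow> Im z = 0 \<and> \<kappa> * y \<le> \<kappa> * Re z"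
  by (auto simp: real_ray_def complex_eq_iff image_iff)

lemma connected_real_ray:
  assumes "\<kappa> = 1 \<or> \<kappa> = -1"
  shows "connected (real_ray \<kappa> y)"
proof -
  have "{x. \<kappa> * y \<le> \<kappa> * x} = (if \<kappa> = 1 then {y..} else {..y})"
    using assms by auto
  then have "convex {x. \<kappa> * y \<le> \<kappa> * x}" by simp
  then show ?thesis
    unfolding real_ray_def by (intro connected_continuous_image continuous_intros convex_connected)
qed

lemma not_bounded_real_ray:
  assumes "\<kappa> = 1 \<or> \<kappa> = -1"
  shows "\<not> bounded (real_ray \<kappa> y)"
proof
  assume "bounded (real_ray \<kappa> y)"
  then obtain B where B: "\<And>z. z \<in> real_ray \<kappa> y \<Longrightarrow> norm z \<le> B"
    by (auto simp: bounded_iff)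
  have "complex_of_real (\<kappa> * (\<bar>y\<bar> + \<bar>B\<bar> + 1)) \<in> real_ray \<kappa> y"
    using assms by (auto simp: in_real_ray_iff)
  from B[OF this] have "\<bar>\<kappa> * (\<bar>y\<bar> + \<bar>B\<bar> + 1)\<bar> \<le> B" by (simp only: norm_of_real)
  then show False using assms by (auto simp: abs_mult)
qed

text \<open>At the reference abscissa this path replaces a piece of the contour by a piece of the
  line. With \<open>r\<close> far away it is an auxiliary comparison path with the same end
  points.\<close>

definition detour :: "real \<Rightarrow> complex \<Rightarrow> complex \<Rightarrow> real \<Rightarrow> complex" where
  "detour r p q = linepath p (Complex r (Im p)) +++ linepath (Complex r (Im p)) (Complex r (Im q)) +++
     linepath (Complex r (Im q)) q"

lemma valid_path_detour [simp]: "valid_path (detour r p q)"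
  by (simp add: detour_def valid_path_join)

lemma path_detour [simp]: "path (detour r p q)"
  by (simp add: valid_path_imp_path)

lemma pathstart_detour [simp]: "pathstart (detour r p q) = p"
  and pathfinish_detour [simp]: "pathfinish (detour r p q) = q"
  by (simp_all add: detour_def)

lemma path_image_detour:
  "path_image (detour r p q) = closed_segment p (Complex r (Im p)) \<union>
     closed_segment (Complex r (Im p)) (Complex r (Im q)) \<union> closed_segment (Complex r (Im q)) q"
  by (auto simp: detour_def path_image_join)

lemma path_image_detour_cases:
  assumes "z \<in> path_image (detour r p q)"
  obtains "Im z = Im p" "Re z \<in> closed_segment (Re p) r" | "Re z = r" 
    | "Im z = Im q" "Re z \<in> closed_segment (Re q) r"
  using assms
  by (auto simp: path_image_detour closed_segment_same_Re closed_segment_same_Im closed_segment_commute)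

text \<open>Closedness makes the complement open, so that its components are path components and an
  escape route can be taken as a compact path. A convergent sequence on the curve has bounded height
  and therefore stays in the image of one compact parameter interval.\<close>

lemma closed_range_vertical:
  fixes g :: "real \<Rightarrow> complex"
  assumes cont: "continuous_on UNIV g"
    and lim: "filterlim (\<lambda>t. Im (g t)) at_bot at_bot" "filterlim (\<lambda>t. Im (g t)) at_top at_top"
  shows "closed (range g)"
  unfolding closed_sequential_limits
proof (intro allI impI)
  fix x l assume xl: "(\<forall>n. x n \<in> range g) \<and> x \<longlonglongrightarrow> l"
  then have "bounded (range x)" by (intro convergent_imp_bounded) auto
  then obtain B where B: "\<And>n. norm (x n) \<le> B" by (auto simp: bounded_iff)
  obtain a b where a: "\<And>t. t \<le> a \<Longrightarrow> Im (g t) \<le> - B - 1" and b: "\<And>t. t \<ge> b \<Longrightarrow> Im (g t) \<ge> B + 1"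
    using lim unfolding filterlim_at_bot filterlim_at_top eventually_at_bot_linorder eventually_at_top_linorder
    by metis
  have "x n \<in> g ` {a..b}" for n
  proof -
    obtain t where t: "x n = g t" using xl by blast
    have "\<bar>Im (g t)\<bar> \<le> B" using B[of n] t abs_Im_le_cmod[of "g t"] by simp
    then have "a \<le> t" "t \<le> b" using a[of t] b[of t] by linarith+
    then show ?thesis using t by auto
  qed
  moreover have "closed (g ` {a..b})"
    using cont by (intro compact_imp_closed compact_continuous_image) (auto intro: continuous_on_subset)
  ultimately have "l \<in> g ` {a..b}" using xl by (metis closed_sequentially)
  then show "l \<in> range g" by blast
qed

lemma real_ray_Int_detour:
  assumes "\<kappa> = 1 \<or> \<kappa> = -1" "Im p \<noteq> 0" "Im q \<noteq> 0" "\<kappa> * r < \<kappa> * y"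
  shows "real_ray \<kappa> y \<inter> path_image (detour r p q) = {}"
proof -
  have "z \<notin> real_ray \<kappa> y" if "z \<in> path_image (detour r p q)" for z
    using that by (cases rule: path_image_detour_cases) (use assms in \<open>auto simp: in_real_ray_iff\<close>)
  then show ?thesis by blast
qed

text \<open>
  A point connected to \<open>\<kappa>\<infinity>\<close> in the complement of the curve can escape along this connection and
  the real axis, without meeting a detour far away on the opposite side; that detour can in turn
  be moved to the given abscissa.
\<close>

lemma eventually_winding_number_eq_detour:
  fixes g :: "real \<Rightarrow> complex" and \<kappa> :: real
  assumes cont: "continuous_on UNIV g"
    and lim: "filterlim (\<lambda>t. Im (g t)) at_bot at_bot" "filterlim (\<lambda>t. Im (g t)) at_top at_top"
    and gR: "\<And>t. \<bar>Re (g t)\<bar> \<le> R"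
    and \<kappa>: "\<kappa> = 1 \<or> \<kappa> = -1"
    and w: "Im w = 0" "\<kappa> * \<rho> < \<kappa> * Re w"
    and esc: "eventually (\<lambda>x. connected_component (- range g) w (of_real (\<kappa> * x))) at_top"
  shows "eventually (\<lambda>n. winding_number (subpath (- real n) (real n) g) w =
           winding_number (detour \<rho> (g (- real n)) (g (real n))) w) sequentially"
proof -
  \<comment> \<open>Beyond \<open>R\<close> the real axis no longer meets the curve, so the escape
    path can be continued to infinity along a ray.\<close>
  have "eventually (\<lambda>x. connected_component (- range g) w (of_real (\<kappa> * x)) \<and> R < x) at_top"
    using esc eventually_gt_at_top by (rule eventually_conj)
  then obtain x1 where "connected_component (- range g) w (of_real (\<kappa> * x1))" and x1: "R < x1"
    using eventually_happens[of _ "at_top :: real filter"] by auto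
  then have "path_component (- range g) w (of_real (\<kappa> * x1))"
    using closed_range_vertical[OF cont lim]
    by (metis open_Compl open_path_connected_component)
  then obtain P where P: "path P" "pathstart P = w" "pathfinish P = of_real (\<kappa> * x1)" "path_image P \<subseteq> - range g"
    unfolding path_component_def by auto
  define x0 where "x0 = \<kappa> * x1"
  have x0: "R < \<kappa> * x0" using \<kappa> x1 by (auto simp: x0_def)
  obtain M0 where M0: "\<And>z. z \<in> path_image P \<Longrightarrow> norm z < M0"
    using bounded_path_image[OF P(1)] by (auto simp: bounded_pos_less)
  define M where "M = max M0 1"
  have M1: "M > 0" by (simp add: M_def)
  have M: "\<bar>Re z\<bar> < M \<and> \<bar>Im z\<bar> < M" if "z \<in> path_image P" for z
    using M0[OF that] abs_Re_le_cmod[of z] abs_Im_le_cmod[of z] by (auto simp: M_def)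
  \<comment> \<open>The vertical side of this detour lies opposite to the escape direction, beyond
    the bounding box of \<open>P\<close>, beyond the start of the ray and beyond
    \<open>w\<close>.\<close>
  define r where "r = - \<kappa> * (M + \<bar>x0\<bar> + \<bar>Re w\<bar> + 1)"
  have r: "\<kappa> * r \<le> - M" "\<kappa> * r < \<kappa> * x0" "\<kappa> * r < \<kappa> * Re w"
    using \<kappa> by (auto simp: r_def M_def)
  let ?T = "path_image P \<union> real_ray \<kappa> x0"
  have T: "connected ?T" "\<not> bounded ?T" "w \<in> ?T"
  proof -
    show "connected ?T"
      using P pathfinish_in_path_image[of P] connected_real_ray[OF \<kappa>]
      by (intro connected_Un connected_path_image) (auto simp: in_real_ray_iff x0_def)
    show "\<not> bounded ?T" using not_bounded_real_ray[OF \<kappa>] by (simp add: bounded_Un)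
    show "w \<in> ?T" using P pathstart_in_path_image[of P] by auto
  qed
  have Tg: "z \<notin> ?T" if "z \<in> range g" for z
  proof -
    obtain t where "z = g t" using \<open>z \<in> range g\<close> by blast
    with gR[of t] x0 \<kappa> have "z \<notin> real_ray \<kappa> x0" by (auto simp: in_real_ray_iff)
    then show ?thesis using that P(4) by blast
  qed
  have "filterlim (\<lambda>n. - real n) at_bot sequentially"
    by (simp add: filterlim_uminus_at_top[symmetric] filterlim_real_sequentially)
  \<comment> \<open>Once both ends are at height at least \<open>M\<close> in absolute value, the
    horizontal sides of the detour miss \<open>P\<close> as well.\<close>
  from filterlim_compose[OF lim(1) this] have "eventually (\<lambda>n. Im (g (- real n)) \<le> - M) sequentially"
    by (auto simp: filterlim_at_bot)
  moreover have "eventually (\<lambda>n. M \<le> Im (g (real n))) sequentially"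
    using filterlim_compose[OF lim(2) filterlim_real_sequentially] by (auto simp: filterlim_at_top)
  ultimately show ?thesis
  proof eventually_elim
    case (elim n)
    let ?p = "subpath (- real n) (real n) g"
    let ?A = "g (- real n)" and ?B = "g (real n)"
    have p: "path ?p"
      unfolding path_def subpath_def
      by (intro continuous_on_compose2[OF cont] continuous_intros) auto
    have pim: "path_image ?p \<subseteq> range g" by (auto simp: path_image_def subpath_def)
    have nz: "Im ?A \<noteq> 0" "Im ?B \<noteq> 0" using elim M1 by auto
    have "z \<notin> path_image P" if "z \<in> path_image (detour r ?A ?B)" for z
      using that
    proof (cases rule: path_image_detour_cases)
      case 2
      then show ?thesis using M[of z] r \<kappa> by auto
    qed (use M[of z] M1 elim in auto)
    then have "?T \<inter> path_image (detour r ?A ?B) = {}"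
      using real_ray_Int_detour[OF \<kappa> nz r(2)] by blast
    then have "winding_number ?p w = winding_number (detour r ?A ?B) w"
      using p pim Tg by (intro winding_number_eq_connected[OF _ _ _ _ T]) auto
    \<comment> \<open>Both abscissae lie on the same side of \<open>w\<close>, so the real ray
      starting at \<open>w\<close> itself avoids both detours.\<close>
    also have "\<dots> = winding_number (detour \<rho> ?A ?B) w"
      using w by (intro winding_number_eq_connected[OF _ _ _ _ connected_real_ray[OF \<kappa>, of "Re w"]]
          not_bounded_real_ray \<kappa> real_ray_Int_detour nz r) (auto simp: in_real_ray_iff)
    finally show ?case .
  qed
qed

text \<open>Beyond the bound \<open>R\<close> the real ray from \<open>w\<close> misses the whole
  curve. The equality therefore holds for every piece with non-real ends, uniformly over infinitely
  many poles.\<close>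

lemma winding_number_eq_detour_far:
  fixes g :: "real \<Rightarrow> complex" and \<kappa> :: real
  assumes gR: "\<And>t. \<bar>Re (g t)\<bar> \<le> R"
    and p: "path p" "path_image p \<subseteq> range g"
    and \<kappa>: "\<kappa> = 1 \<or> \<kappa> = -1"
    and w: "Im w = 0" "\<kappa> * \<rho> < \<kappa> * Re w" "R < \<kappa> * Re w"
    and ends: "Im (pathstart p) \<noteq> 0" "Im (pathfinish p) \<noteq> 0"
  shows "winding_number p w = winding_number (detour \<rho> (pathstart p) (pathfinish p)) w"
proof (intro winding_number_eq_connected[OF p(1) _ _ _ connected_real_ray[OF \<kappa>, of "Re w"]]
    not_bounded_real_ray \<kappa> real_ray_Int_detour ends w(2))
  have "z \<notin> real_ray \<kappa> (Re w)" if "z \<in> range g" for z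
  proof -
    obtain t where "z = g t" using \<open>z \<in> range g\<close> by blast
    with gR[of t] w(3) \<kappa> show ?thesis by (auto simp: in_real_ray_iff)
  qed
  then show "real_ray \<kappa> (Re w) \<inter> path_image p = {}" using p(2) by blast
qed (use w in \<open>auto simp: in_real_ray_iff\<close>)

section \<open>Integrals along truncated contours and passage to the limit\<close>

lemma has_contour_integral_subpath_real:
  fixes g :: "real \<Rightarrow> complex"
  assumes ab: "a < b" and g: "g piecewise_C1_differentiable_on {a..b}"
    and int: "((\<lambda>t. f (g t) * vector_derivative g (at t)) has_integral J) {a..b}"
  shows "valid_path (subpath a b g)" "(f has_contour_integral J) (subpath a b g)"
proof -
  have img: "(\<lambda>x. (b - a) * x + a) ` {0..1} = {a..b}"
    using ab by (subst image_affinity_atLeastAtMost) auto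
  have "(g \<circ> (\<lambda>x. (b - a) *\<^sub>R x + a)) piecewise_C1_differentiable_on {0..1}"
    by (rule piecewise_C1_differentiable_affine) (use g img in simp)
  then show "valid_path (subpath a b g)"
    by (simp add: valid_path_def subpath_def o_def)
  obtain S where S: "finite S" "\<And>x. x \<in> {a..b} - S \<Longrightarrow> g differentiable at x"
    using g unfolding piecewise_C1_differentiable_on_def C1_differentiable_on_eq by blast
  have "((\<lambda>x. f (g ((b - a) *\<^sub>R x + a)) * vector_derivative g (at ((b - a) *\<^sub>R x + a)))
            has_integral J /\<^sub>R (b - a)) {0..1}"
    using has_integral_affinity'[OF int[unfolded cbox_interval[symmetric]], of "b - a" a] ab by simp
  from has_integral_mult_right[OF this, of "of_real (b - a)"]
  have *: "((\<lambda>x. of_real (b - a) * (f (g ((b - a) * x + a)) * vector_derivative g (at ((b - a) * x + a))))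
            has_integral J) {0..1}"
    using ab by (simp add: scaleR_conv_of_real mult.assoc[symmetric] flip: of_real_diff)
  have vd: "vector_derivative (\<lambda>x. g ((b - a) * x + a)) (at x) = (b - a) *\<^sub>R vector_derivative g (at ((b - a) * x + a))"
    if "x \<in> {0..1}" "(b - a) * x + a \<notin> S" for x
  proof (rule vector_derivative_at [OF vector_diff_chain_at [simplified o_def]])
    show "((\<lambda>x. (b - a) * x + a) has_vector_derivative b - a) (at x)"
      by (intro derivative_eq_intros | simp)+
    have "(b - a) * x + a \<in> {a..b}" using that(1) img by blast
    then show "(g has_vector_derivative vector_derivative g (at ((b - a) * x + a))) (at ((b - a) * x + a))"
      using S(2) that(2) by (simp add: vector_derivative_works)
  qed
  \<comment> \<open>The chain rule fails at most at the parameters of the corners of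
    \<open>g\<close>; finitely many values do not affect the integral.\<close>
  have "finite ((\<lambda>x. (b - a) * x + a) -` S)"
    using S(1) ab by (intro finite_vimageI) (auto simp: inj_on_def)
  then show "(f has_contour_integral J) (subpath a b g)"
    unfolding has_contour_integral subpath_def
    by (rule has_integral_spike_finite[OF _ _ *]) (auto simp: vd scaleR_conv_of_real)
qed

lemma vertical_contour_continuous:
  assumes "vertical_contour \<gamma> g"
  shows "continuous_on UNIV g"
proof -
  have "isCont g x" for x
  proof -
    have "continuous_on {x - 1..x + 1} g"
      using assms by (auto simp: vertical_contour_def piecewise_C1_differentiable_on_def)
    then show ?thesis by (rule continuous_on_interior) simp
  qed
  then show ?thesis by (simp add: continuous_on_eq_continuous_at)
qed

text \<open>Near both ends the real part is within 1 of \<open>\<gamma>\<close>, and a compact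
  interval remains. The free lower bound \<open>B\<close> lets the same strip contain the reference
  line too.\<close>

lemma vertical_contour_Re_bounded:
  assumes vc: "vertical_contour \<gamma> g"
  obtains R where "R \<ge> B" "\<And>t. \<bar>Re (g t)\<bar> \<le> R"
proof -
  have "eventually (\<lambda>t. dist (Re (g t)) \<gamma> < 1) at_bot" "eventually (\<lambda>t. dist (Re (g t)) \<gamma> < 1) at_top"
    using vc by (auto simp: vertical_contour_def intro!: tendstoD)
  then obtain a b where ab: "\<And>t. t \<le> a \<Longrightarrow> dist (Re (g t)) \<gamma> < 1" "\<And>t. t \<ge> b \<Longrightarrow> dist (Re (g t)) \<gamma> < 1"
    unfolding eventually_at_bot_linorder eventually_at_top_linorder by metis
  have "bounded (g ` {a..b})"
    using vertical_contour_continuous[OF vc]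
    by (intro compact_imp_bounded compact_continuous_image) (auto intro: continuous_on_subset)
  then obtain D where D: "\<And>t. t \<in> {a..b} \<Longrightarrow> norm (g t) \<le> D"
    unfolding bounded_iff by (metis imageI)
  have "\<bar>Re (g t)\<bar> \<le> max B (max D (\<bar>\<gamma>\<bar> + 1))" for t
  proof (cases "t \<in> {a..b}")
    case True
    then show ?thesis using D[OF True] abs_Re_le_cmod[of "g t"] by linarith
  next
    case False
    then have "dist (Re (g t)) \<gamma> < 1" using ab[of t] by (cases "t \<le> a") auto
    then show ?thesis unfolding dist_real_def by linarith
  qed
  then show thesis by (intro that[of "max B (max D (\<bar>\<gamma>\<bar> + 1))"]) auto
qed

lemma not_in_range_left_of: "w \<in> left_of g \<Longrightarrow> w \<notin> range g"
  and not_in_range_right_of: "w \<in> right_of g \<Longrightarrow> w \<notin> range g"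
  unfolding left_of_def right_of_def
  by (auto dest!: eventually_happens dest: connected_component_in)

lemma horizontal_segment_bound:
  fixes F :: "complex \<Rightarrow> complex"
  assumes contF: "continuous_on (- S) F" and S: "\<And>w. w \<in> S \<Longrightarrow> Im w = 0"
    and C: "\<And>s. \<bar>Re s\<bar> \<le> R \<Longrightarrow> 1 \<le> \<bar>Im s\<bar> \<Longrightarrow> norm (F s) \<le> C / (Im s)\<^sup>2"
    and z: "Im z = Im z'" "\<bar>Re z\<bar> \<le> R" "\<bar>Re z'\<bar> \<le> R" "1 \<le> \<bar>Im z\<bar>"
  shows "F contour_integrable_on linepath z z'"
    and "norm (contour_integral (linepath z z') F) \<le> C / (Im z)\<^sup>2 * (2 * R)"
proof -
  have seg: "Im x = Im z" "\<bar>Re x\<bar> \<le> R" if x: "x \<in> closed_segment z z'" for x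
  proof -
    have x': "Im x = Im z" "Re x \<in> closed_segment (Re z) (Re z')"
      using x closed_segment_same_Im[OF z(1)] by auto
    then show "Im x = Im z" by simp
    from x' show "\<bar>Re x\<bar> \<le> R"
      using z(2,3) by (auto simp: closed_segment_eq_real_ivl split: if_splits)
  qed
  have "closed_segment z z' \<subseteq> - S"
  proof
    fix x assume "x \<in> closed_segment z z'"
    then have "Im x \<noteq> 0" using seg(1)[of x] z(4) by auto
    then show "x \<in> - S" using S by blast
  qed
  then show int: "F contour_integrable_on linepath z z'"
    by (intro contour_integrable_continuous_linepath continuous_on_subset[OF contF])
  have "norm (F z) \<le> C / (Im z)\<^sup>2" by (rule C[OF z(2,4)])
  then have C0: "0 \<le> C / (Im z)\<^sup>2" using norm_ge_zero[of "F z"] by linarith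
  have "norm (contour_integral (linepath z z') F) \<le> C / (Im z)\<^sup>2 * norm (z' - z)"
  proof (rule contour_integral_bound_linepath[OF int C0])
    fix x assume "x \<in> closed_segment z z'"
    then show "norm (F x) \<le> C / (Im z)\<^sup>2" using C[of x] seg[of x] z(4) by simp
  qed
  also have "\<dots> \<le> C / (Im z)\<^sup>2 * (2 * R)"
  proof (rule mult_left_mono[OF _ C0])
    have "z' - z = of_real (Re z' - Re z)" using z(1) by (simp add: complex_eq_iff)
    then have "norm (z' - z) = \<bar>Re z' - Re z\<bar>" by (simp only: norm_of_real)
    then show "norm (z' - z) \<le> 2 * R" using z(2,3) by linarith
  qed
  finally show "norm (contour_integral (linepath z z') F) \<le> C / (Im z)\<^sup>2 * (2 * R)" .
qed

text \<open>On \<open>[-n, n]\<close> the contour is exchanged for the detour through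
  \<open>Re s = \<rho>\<close>. The horizontal sides have length at most \<open>2 * R\<close> and
  escape to infinite height, so the decay removes them; the vertical side carries
  \<open>ds = \<i> du\<close>. The integral along the contour may converge only conditionally, which
  is why the comparison runs through truncations.\<close>

theorem vertical_contour_integral_eq:
  fixes F :: "complex \<Rightarrow> complex" and \<rho> :: real
  assumes vc: "vertical_contour \<gamma> g"
    and S: "closed S" "\<And>w. w \<in> S \<Longrightarrow> Im w = 0" "\<And>R. finite {w \<in> S. \<bar>Re w\<bar> \<le> R}"
    and sides: "\<And>w. w \<in> S \<Longrightarrow> Re w < \<rho> \<and> w \<in> left_of g \<or> \<rho> < Re w \<and> w \<in> right_of g"
    and holo: "F holomorphic_on (- S)"
    and decay: "\<And>R. \<exists>C. \<forall>s. \<bar>Re s\<bar> \<le> R \<longrightarrow> 1 \<le> \<bar>Im s\<bar> \<longrightarrow> norm (F s) \<le> C / (Im s)\<^sup>2"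
    and int: "((\<lambda>t. F (g t) * vector_derivative g (at t)) has_integral I) UNIV"
  shows "I = \<i> * (LINT u|lborel. F (Complex \<rho> u))"
proof -
  note cont = vertical_contour_continuous[OF vc]
  have lim: "filterlim (\<lambda>t. Im (g t)) at_bot at_bot" "filterlim (\<lambda>t. Im (g t)) at_top at_top"
    using vc by (auto simp: vertical_contour_def)
  obtain R where R: "R \<ge> \<bar>\<rho>\<bar>" and gR: "\<And>t. \<bar>Re (g t)\<bar> \<le> R"
    using vertical_contour_Re_bounded[OF vc] by blast
  obtain C where C: "\<And>s. \<bar>Re s\<bar> \<le> R \<Longrightarrow> 1 \<le> \<bar>Im s\<bar> \<Longrightarrow> norm (F s) \<le> C / (Im s)\<^sup>2"
    using decay by blast
  have oS: "open (- S)" using S(1) by auto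
  have contF: "continuous_on (- S) F" using holo by (rule holomorphic_on_imp_continuous_on)
  have line: "Complex \<rho> u \<notin> S" for u using sides[of "Complex \<rho> u"] by auto
  have intF: "integrable lborel (\<lambda>u. F (Complex \<rho> u))"
  proof (rule integrable_inverse_square_decay)
    have "continuous_on UNIV (Complex \<rho>)" unfolding Complex_eq by (intro continuous_intros)
    then show "continuous_on UNIV (\<lambda>u. F (Complex \<rho> u))"
      using line by (intro continuous_on_compose2[OF contF]) auto
    show "norm (F (Complex \<rho> u)) \<le> C / u\<^sup>2" if "1 \<le> \<bar>u\<bar>" for u
      using C[of "Complex \<rho> u"] that R by simp
  qed
  define A where "A n = g (- real n)" for n
  define B where "B n = g (real n)" for n
  have nb: "filterlim (\<lambda>n. - real n) at_bot sequentially"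
    by (simp add: filterlim_uminus_at_top[symmetric] filterlim_real_sequentially)
  have ImA: "filterlim (\<lambda>n. Im (A n)) at_bot sequentially"
    unfolding A_def by (rule filterlim_compose[OF lim(1) nb])
  have ImB: "filterlim (\<lambda>n. Im (B n)) at_top sequentially"
    unfolding B_def by (rule filterlim_compose[OF lim(2) filterlim_real_sequentially])
  define V where "V n = detour \<rho> (A n) (B n)" for n
  define p where "p n = subpath (- real n) (real n) g" for n
  have pim: "path_image (p n) \<subseteq> range g" for n by (auto simp: p_def path_image_def subpath_def)
  have pst: "pathstart (p n) = A n" "pathfinish (p n) = B n" for n
    by (simp_all add: p_def A_def B_def)
  have ppath: "path (p n)" for n
    unfolding p_def path_def subpath_def
    by (intro continuous_on_compose2[OF cont] continuous_intros) auto
  have evI: "eventually (\<lambda>n. Im (A n) \<le> -1 \<and> 1 \<le> Im (B n) \<and> n > 0) sequentially"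
    using ImA ImB by (intro eventually_conj) (auto simp: filterlim_at_bot filterlim_at_top eventually_gt_at_top)
  \<comment> \<open>\<open>left_of\<close> looks towards minus infinity, whereas the signed form of
    the escape condition always lets its parameter tend to plus infinity.\<close>
  have mirror: "eventually (\<lambda>x. Q (- x)) at_top" if "eventually Q at_bot" for Q :: "real \<Rightarrow> bool"
    using that by (simp add: at_bot_mirror eventually_filtermap)
  have "eventually (\<lambda>n. winding_number (p n) w = winding_number (V n) w) sequentially" if w: "w \<in> S" for w
    using sides[OF w]
  proof (elim disjE conjE)
    assume "Re w < \<rho>" "w \<in> left_of g"
    then have "eventually (\<lambda>x. connected_component (- range g) w (of_real (-1 * x))) at_top"
      using mirror[of "\<lambda>x. connected_component (- range g) w (of_real x)"] by (simp add: left_of_def)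
    with \<open>Re w < \<rho>\<close> show ?thesis
      using eventually_winding_number_eq_detour[OF cont lim gR, of "-1" w \<rho>] S(2)[OF w]
      unfolding p_def V_def A_def B_def by auto
  next
    assume "\<rho> < Re w" "w \<in> right_of g"
    then show ?thesis
      using eventually_winding_number_eq_detour[OF cont lim gR, of 1 w \<rho>] S(2)[OF w]
      unfolding p_def V_def A_def B_def right_of_def by auto
  qed
  \<comment> \<open>Only finitely many poles lie in the strip, so their thresholds have a common
    bound; poles outside the strip are treated below for each \<open>n\<close> separately.\<close>
  then have "eventually (\<lambda>n. \<forall>w\<in>{w\<in>S. \<bar>Re w\<bar> \<le> R}. winding_number (p n) w = winding_number (V n) w) sequentially"
    using S(3) by (intro eventually_ball_finite) auto
  with evI have ev: "eventually (\<lambda>n. Im (A n) \<le> -1 \<and> 1 \<le> Im (B n) \<and> n > 0 \<and>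
      (\<forall>w\<in>S. winding_number (p n) w = winding_number (V n) w)) sequentially"
  proof eventually_elim
    case (elim n)
    have "winding_number (p n) w = winding_number (V n) w" if w: "w \<in> S" for w
    proof (cases "\<bar>Re w\<bar> \<le> R")
      case False
      then consider "Re w < - R" | "R < Re w" by linarith
      then show ?thesis
      proof cases
        case 1
        then show ?thesis
          using winding_number_eq_detour_far[OF gR ppath pim, of "-1" w \<rho> n] S(2)[OF w] R elim
          unfolding pst V_def by auto
      next
        case 2
        then show ?thesis
          using winding_number_eq_detour_far[OF gR ppath pim, of 1 w \<rho> n] S(2)[OF w] R elim
          unfolding pst V_def by auto
      qed
    qed (use elim w in auto)
    then show ?case using elim by blast
  qed
  define H1 where "H1 n = contour_integral (linepath (A n) (Complex \<rho> (Im (A n)))) F" for n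
  define H2 where "H2 n = contour_integral (linepath (Complex \<rho> (Im (B n))) (B n)) F" for n
  have gS: "range g \<subseteq> - S"
    using sides not_in_range_left_of not_in_range_right_of by blast
  note hor = horizontal_segment_bound[OF contF S(2) C]
  have AR: "\<bar>Re (A n)\<bar> \<le> R" "\<bar>Re (B n)\<bar> \<le> R" for n using gR by (auto simp: A_def B_def)
  have evH: "eventually (\<lambda>n. norm (H1 n) \<le> C / (Im (A n))\<^sup>2 * (2 * R) \<and> norm (H2 n) \<le> C / (Im (B n))\<^sup>2 * (2 * R)) sequentially"
    using evI
  proof eventually_elim
    case (elim n)
    then show ?case
      using hor(2)[where z = "A n" and z' = "Complex \<rho> (Im (A n))"] hor(2)[where z = "Complex \<rho> (Im (B n))" and z' = "B n"] AR[of n] R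
      by (auto simp: H1_def H2_def)
  qed
  have "((\<lambda>x. C / x\<^sup>2 * (2 * R)) \<longlongrightarrow> 0) at_bot" "((\<lambda>x. C / x\<^sup>2 * (2 * R)) \<longlongrightarrow> 0) at_top"
    by real_asymp+
  note zero = filterlim_compose[OF this(1) ImA] filterlim_compose[OF this(2) ImB]
  have H0: "H1 \<longlonglongrightarrow> 0" "H2 \<longlonglongrightarrow> 0"
    by (rule Lim_null_comparison[OF _ zero(1)] Lim_null_comparison[OF _ zero(2)],
        use evH in eventually_elim, simp)+
  have "eventually (\<lambda>n. integral {- real n..real n} (\<lambda>t. F (g t) * vector_derivative g (at t)) =
      H1 n + \<i> * integral {Im (A n)..Im (B n)} (\<lambda>u. F (Complex \<rho> u)) + H2 n) sequentially"
    using ev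
  proof eventually_elim
    case (elim n)
    let ?f = "\<lambda>t. F (g t) * vector_derivative g (at t)"
    have "?f integrable_on {- real n..real n}"
      using int by (meson has_integral_integrable integrable_on_subinterval subset_UNIV)
    then have "(?f has_integral integral {- real n..real n} ?f) {- real n..real n}"
      by (rule integrable_integral)
    moreover have "g piecewise_C1_differentiable_on {- real n..real n}"
      using vc by (auto simp: vertical_contour_def)
    ultimately have vp: "valid_path (p n)" and ip: "(F has_contour_integral integral {- real n..real n} ?f) (p n)"
      using has_contour_integral_subpath_real[of "- real n" "real n" g F] elim unfolding p_def by auto
    \<comment> \<open>\<open>S\<close> is real: the horizontal sides have height at least 1 in
      absolute value, and on the vertical side \<open>Re z = \<rho>\<close>, which no point of
      \<open>S\<close> satisfies.\<close>
    have Vim: "path_image (V n) \<subseteq> - S"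
    proof
      fix z assume "z \<in> path_image (V n)"
      then show "z \<in> - S"
        unfolding V_def
      proof (cases rule: path_image_detour_cases)
        case 2
        then show ?thesis using sides[of z] by auto
      qed (use elim S(2)[of z] in auto)
    qed
    have iV: "F contour_integrable_on V n"
      using holo oS Vim by (intro contour_integrable_holomorphic_simple[of F "- S"]) (auto simp: V_def)
    have "(F has_contour_integral 0) (p n +++ reversepath (V n))"
    proof (rule Cauchy_theorem_global[OF oS holo])
      show "valid_path (p n +++ reversepath (V n))"
        using vp by (intro valid_path_join) (auto simp: pst V_def)
      show "pathfinish (p n +++ reversepath (V n)) = pathstart (p n +++ reversepath (V n))"
        by (simp add: pst V_def)
      show "path_image (p n +++ reversepath (V n)) \<subseteq> - S"
        using pim gS Vim by (subst path_image_join) (auto simp: pst V_def)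
      fix w assume "w \<notin> - S"
      then have w: "w \<in> S" by simp
      then have "w \<notin> path_image (p n)" "w \<notin> path_image (V n)" using pim gS Vim by blast+
      then have "winding_number (p n +++ reversepath (V n)) w = winding_number (p n) w - winding_number (V n) w"
        using ppath by (subst winding_number_join) (auto simp: pst V_def winding_number_reversepath)
      then show "winding_number (p n +++ reversepath (V n)) w = 0"
        using elim w by simp
    qed
    moreover have "(F has_contour_integral (integral {- real n..real n} ?f + - contour_integral (V n) F)) (p n +++ reversepath (V n))"
      using iV vp ip
      by (intro has_contour_integral_join has_contour_integral_reversepath has_contour_integral_integral)
         (auto simp: V_def)
    ultimately have "0 = integral {- real n..real n} ?f + - contour_integral (V n) F"
      by (rule has_contour_integral_unique)
    then have "integral {- real n..real n} ?f = contour_integral (V n) F" by simp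
    also have "\<dots> = H1 n + (contour_integral (linepath (Complex \<rho> (Im (A n))) (Complex \<rho> (Im (B n)))) F + H2 n)"
    proof -
      have "F contour_integrable_on linepath (Complex \<rho> (Im (A n))) (Complex \<rho> (Im (B n)))"
        using Vim by (intro contour_integrable_continuous_linepath continuous_on_subset[OF contF])
          (auto simp: V_def path_image_detour)
      moreover have "F contour_integrable_on linepath (A n) (Complex \<rho> (Im (A n)))"
        "F contour_integrable_on linepath (Complex \<rho> (Im (B n))) (B n)"
        using elim AR R by (auto intro!: hor(1))
      ultimately show ?thesis
        by (simp add: V_def detour_def H1_def H2_def contour_integrable_join)
    qed
    also have "contour_integral (linepath (Complex \<rho> (Im (A n))) (Complex \<rho> (Im (B n)))) F =
        \<i> * integral {Im (A n)..Im (B n)} (\<lambda>u. F (Complex \<rho> u))"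
      using elim by (intro contour_integral_linepath_same_Re) auto
    finally show ?case by simp
  qed
  moreover have "(\<lambda>n. H1 n + \<i> * integral {Im (A n)..Im (B n)} (\<lambda>u. F (Complex \<rho> u)) + H2 n)
      \<longlonglongrightarrow> 0 + \<i> * (LINT u|lborel. F (Complex \<rho> u)) + 0"
    by (intro tendsto_intros H0 has_integral_UNIV_tendsto has_integral_integral_lborel intF ImA ImB)
  ultimately have "(\<lambda>n. integral {- real n..real n} (\<lambda>t. F (g t) * vector_derivative g (at t)))
      \<longlonglongrightarrow> 0 + \<i> * (LINT u|lborel. F (Complex \<rho> u)) + 0"
    using tendsto_cong by force
  moreover have "(\<lambda>n. integral {- real n..real n} (\<lambda>t. F (g t) * vector_derivative g (at t))) \<longlonglongrightarrow> I"
    by (rule has_integral_UNIV_tendsto[OF int nb filterlim_real_sequentially])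
  ultimately show ?thesis
    using LIMSEQ_unique by fastforce
qed

section \<open>The kernel of the E-function\<close>

text \<open>All poles are real, so bounds are asked for only at height at least 1. Mere boundedness
  is closed under products and suffices for the factors that accompany
  \<open>Gamma (- s)\<close>.\<close>

definition strip_bounded :: "(complex \<Rightarrow> complex) \<Rightarrow> bool" where
  "strip_bounded M \<longleftrightarrow> (\<forall>R. \<exists>C. \<forall>s. \<bar>Re s\<bar> \<le> R \<longrightarrow> 1 \<le> \<bar>Im s\<bar> \<longrightarrow> norm (M s) \<le> C)"

lemma strip_boundedE:
  assumes "strip_bounded M"
  obtains C where "C \<ge> 0" "\<And>s. \<bar>Re s\<bar> \<le> R \<Longrightarrow> 1 \<le> \<bar>Im s\<bar> \<Longrightarrow> norm (M s) \<le> C"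
proof -
  obtain C where "\<forall>s. \<bar>Re s\<bar> \<le> R \<longrightarrow> 1 \<le> \<bar>Im s\<bar> \<longrightarrow> norm (M s) \<le> C"
    using assms unfolding strip_bounded_def by blast
  then show thesis by (intro that[of "max C 0"]) (auto simp: le_max_iff_disj)
qed

lemma strip_bounded_mult:
  assumes "strip_bounded M" "strip_bounded N"
  shows "strip_bounded (\<lambda>s. M s * N s)"
  unfolding strip_bounded_def
proof
  fix R
  obtain C where C: "C \<ge> 0" "\<And>s. \<bar>Re s\<bar> \<le> R \<Longrightarrow> 1 \<le> \<bar>Im s\<bar> \<Longrightarrow> norm (M s) \<le> C"
    using strip_boundedE[OF assms(1)] by blast
  obtain D where D: "D \<ge> 0" "\<And>s. \<bar>Re s\<bar> \<le> R \<Longrightarrow> 1 \<le> \<bar>Im s\<bar> \<Longrightarrow> norm (N s) \<le> D"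
    using strip_boundedE[OF assms(2)] by blast
  show "\<exists>C. \<forall>s. \<bar>Re s\<bar> \<le> R \<longrightarrow> 1 \<le> \<bar>Im s\<bar> \<longrightarrow> norm (M s * N s) \<le> C"
    using C D by (intro exI[of _ "C * D"]) (auto simp: norm_mult intro!: mult_mono)
qed

lemma strip_bounded_prod_list:
  "(\<And>M. M \<in> set Ms \<Longrightarrow> strip_bounded M) \<Longrightarrow> strip_bounded (\<lambda>s. \<Prod>M\<leftarrow>Ms. M s)"
proof (induction Ms)
  case Nil
  show ?case by (auto simp: strip_bounded_def)
next
  case (Cons M Ms)
  then show ?case by (auto intro: strip_bounded_mult)
qed

lemma strip_bounded_Gamma: "strip_bounded (\<lambda>s. Gamma (of_real b + s))"
  unfolding strip_bounded_def
proof
  fix R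
  obtain C where C: "C \<ge> 0" "\<And>w. \<bar>Re w\<bar> \<le> R + \<bar>b\<bar> \<Longrightarrow> 1 \<le> \<bar>Im w\<bar> \<Longrightarrow> norm (Gamma w) \<le> C / (Im w)\<^sup>2"
    using Gamma_decay_on_strip by blast
  have "norm (Gamma (of_real b + s)) \<le> C" if "\<bar>Re s\<bar> \<le> R" "1 \<le> \<bar>Im s\<bar>" for s
  proof -
    have "norm (Gamma (of_real b + s)) \<le> C / (Im s)\<^sup>2"
      using C(2)[of "of_real b + s"] that by simp
    also have "\<dots> \<le> C / 1"
      using C(1) one_le_power[OF that(2), of 2] by (intro divide_left_mono) auto
    finally show ?thesis by simp
  qed
  then show "\<exists>C. \<forall>s. \<bar>Re s\<bar> \<le> R \<longrightarrow> 1 \<le> \<bar>Im s\<bar> \<longrightarrow> norm (Gamma (of_real b + s)) \<le> C" by blast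
qed

lemma strip_bounded_Gamma_ratio:
  assumes "c < d"
  shows "strip_bounded (\<lambda>s. Gamma (of_real c + s) * rGamma (of_real d + s))"
  unfolding strip_bounded_def
proof
  fix R
  obtain C where C: "\<And>w. \<bar>Re w\<bar> \<le> R + \<bar>c\<bar> \<Longrightarrow> 1 \<le> \<bar>Im w\<bar> \<Longrightarrow> norm (Gamma w * rGamma (w + of_real (d - c))) \<le> C"
    using Gamma_ratio_bounded_on_strip[of "d - c"] assms by (metis diff_gt_0_iff_gt)
  have "norm (Gamma (of_real c + s) * rGamma (of_real d + s)) \<le> C" if "\<bar>Re s\<bar> \<le> R" "1 \<le> \<bar>Im s\<bar>" for s
    using C[of "of_real c + s"] that by (simp add: algebra_simps)
  then show "\<exists>C. \<forall>s. \<bar>Re s\<bar> \<le> R \<longrightarrow> 1 \<le> \<bar>Im s\<bar> \<longrightarrow> norm (Gamma (of_real c + s) * rGamma (of_real d + s)) \<le> C"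
    by blast
qed

lemma positive_fourier_prod_list:
  assumes "positive_fourier G" "\<And>M. M \<in> set Ms \<Longrightarrow> \<exists>v. cf_of_density v (\<lambda>u. M (Complex \<rho> u))"
  shows "positive_fourier (\<lambda>u. G u * (\<Prod>M\<leftarrow>Ms. M (Complex \<rho> u)))"
  using assms
proof (induction Ms arbitrary: G)
  case (Cons M Ms)
  obtain v where "cf_of_density v (\<lambda>u. M (Complex \<rho> u))" using Cons.prems(2)[of M] by auto
  with Cons.prems(1) have "positive_fourier (\<lambda>u. G u * M (Complex \<rho> u))" by (rule positive_fourier_mult)
  from Cons.IH[OF this] Cons.prems(2) show ?case by (simp add: mult.assoc)
qed simp

text \<open>After \<open>u\<close> is replaced by \<open>-u\<close>, Mellin inversion at
  \<open>L = - y\<close> gives the explicit transform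
  \<open>2 * pi * exp (- (\<epsilon> * y)) * exp (- exp (- y))\<close>.\<close>

lemma positive_fourier_Gamma:
  assumes "\<epsilon> > 0"
  shows "positive_fourier (\<lambda>u. Gamma (- Complex (- \<epsilon>) u))"
proof -
  have eni: "complex_of_real \<epsilon> \<notin> \<int>\<^sub>\<le>\<^sub>0" using assms by (intro not_nonpos_Int_complex) auto
  have neg: "- Complex (- \<epsilon>) u = Complex \<epsilon> (- u)" for u by (simp add: complex_eq_iff)
  have "integrable lborel (\<lambda>u. Gamma (Complex \<epsilon> (- u)))"
    using lborel_integrable_real_affine[OF integrable_Gamma_vertical[OF eni], of "-1" 0] by simp
  moreover have "(LINT u|lborel. Gamma (Complex \<epsilon> (- u)) * cis (- (u * y))) =
      complex_of_real (exp (- (\<epsilon> * y)) * (2 * pi * exp (- exp (- y))))" for y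
  proof -
    have e: "exp (- (Complex \<epsilon> u * of_real (- y))) = of_real (exp (\<epsilon> * y)) * cis (u * y)" for u
      by (simp add: cis_conv_exp Complex_eq exp_add[symmetric] exp_of_real[symmetric] algebra_simps)
    have "(LINT u|lborel. Gamma (Complex \<epsilon> (- u)) * cis (- (u * y))) = (LINT u|lborel. Gamma (Complex \<epsilon> u) * cis (u * y))"
      using lborel_integral_real_affine[of "-1" "\<lambda>u. Gamma (Complex \<epsilon> u) * cis (u * y)" 0] by simp
    moreover have "complex_of_real (exp (\<epsilon> * y)) * (LINT u|lborel. Gamma (Complex \<epsilon> u) * cis (u * y)) =
        of_real (2 * pi * exp (- exp (- y)))"
      unfolding Gamma_Mellin_inversion[OF assms, of "- y", symmetric] e
        integral_mult_right_zero[symmetric]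
      by (simp only: mult.left_commute)
    ultimately have "complex_of_real (exp (\<epsilon> * y)) * (LINT u|lborel. Gamma (Complex \<epsilon> (- u)) * cis (- (u * y))) =
        of_real (2 * pi * exp (- exp (- y)))" by simp
    then have "complex_of_real (exp (- (\<epsilon> * y)) * exp (\<epsilon> * y)) * (LINT u|lborel. Gamma (Complex \<epsilon> (- u)) * cis (- (u * y))) =
        of_real (exp (- (\<epsilon> * y)) * (2 * pi * exp (- exp (- y))))"
      unfolding of_real_mult by (simp only: mult.assoc)
    then show ?thesis by (simp add: exp_add[symmetric])
  qed
  ultimately show ?thesis
    unfolding positive_fourier_def neg by (auto intro!: exI[of _ "exp (- (\<epsilon> * _)) * (2 * pi * exp (- exp (- _)))"])
qed

section \<open>Poles and explicit form of the kernel\<close>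

lemma is_pole_Gamma_affine:
  fixes a k :: complex
  assumes "k \<noteq> 0"
  shows "is_pole (\<lambda>s. Gamma (a + k * s)) w \<longleftrightarrow> a + k * w \<in> \<int>\<^sub>\<le>\<^sub>0"
proof
  assume pole: "is_pole (\<lambda>s. Gamma (a + k * s)) w"
  show "a + k * w \<in> \<int>\<^sub>\<le>\<^sub>0"
  proof (rule ccontr)
    assume "a + k * w \<notin> \<int>\<^sub>\<le>\<^sub>0"
    then have "((\<lambda>s. Gamma (a + k * s)) \<longlongrightarrow> Gamma (a + k * w)) (at w)"
      by (intro tendsto_intros) auto
    then show False
      using pole not_tendsto_and_filterlim_at_infinity[of "at w"] unfolding is_pole_def by auto
  qed
next
  assume "a + k * w \<in> \<int>\<^sub>\<le>\<^sub>0"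
  then obtain n where n: "a + k * w = - of_nat n" by (elim nonpos_Ints_cases')
  have "filterlim (\<lambda>s. a + k * s) (at (a + k * w)) (at w)"
    using assms by (auto simp: filterlim_at eventually_at_filter intro!: tendsto_intros)
  then show "is_pole (\<lambda>s. Gamma (a + k * s)) w"
    unfolding is_pole_def using filterlim_compose[OF Gamma_poles[of n]] by (simp add: n)
qed

lemma left_poles_eq:
  "left_poles (length bs) (map (\<lambda>\<beta>. (\<beta>, 1)) (map complex_of_real bs)) = {w. \<exists>\<beta>\<in>set bs. of_real \<beta> + w \<in> \<int>\<^sub>\<le>\<^sub>0}"
proof -
  have "w \<in> left_poles (length bs) (map (\<lambda>\<beta>. (\<beta>, 1)) (map complex_of_real bs)) \<longleftrightarrow>
      (\<exists>j<length bs. of_real (bs ! j) + w \<in> \<int>\<^sub>\<le>\<^sub>0)" for w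
    unfolding left_poles_def mem_Collect_eq
    by (intro ex_cong1 conj_cong refl) (use is_pole_Gamma_affine[of 1 "of_real (bs ! _)" w] in simp)
  moreover have "(\<exists>\<beta>\<in>set bs. of_real \<beta> + w \<in> \<int>\<^sub>\<le>\<^sub>0) \<longleftrightarrow> (\<exists>j<length bs. of_real (bs ! j) + w \<in> \<int>\<^sub>\<le>\<^sub>0)"
    for w :: complex by (metis in_set_conv_nth)
  ultimately show ?thesis by blast
qed

lemma right_poles_eq: "right_poles 1 ((1, 1) # xs) = {w. - w \<in> \<int>\<^sub>\<le>\<^sub>0}"
  using is_pole_Gamma_affine[of "-1" 0] by (auto simp: right_poles_def)

lemma prod_list_zip_mult:
  fixes f g :: "'a \<Rightarrow> 'b :: comm_monoid_mult"
  assumes "length xs = length ys"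
  shows "(\<Prod>(x, y)\<leftarrow>zip xs ys. f x * g y) = (\<Prod>x\<leftarrow>xs. f x) * (\<Prod>y\<leftarrow>ys. g y)"
  using assms by (induction xs ys rule: list_induct2) (simp_all add: mult_ac)

lemma prod_lessThan_nth: "(\<Prod>j<length xs. f (xs ! j)) = (\<Prod>x\<leftarrow>xs. f x)"
  using prod.list_conv_set_nth[of "map f xs"] by (simp add: atLeast0LessThan)

lemma prod_list_inverse: "(\<Prod>x\<leftarrow>xs. inverse (f x)) = inverse (\<Prod>x\<leftarrow>xs. f x :: 'a :: field)"
  by (induction xs) simp_all

text \<open>The upper pair \<open>(1, 1)\<close> yields \<open>Gamma (1 - 1 - s)\<close>. Writing
  the denominator with the entire function \<open>rGamma\<close> gives an identity at every
  \<open>s\<close>, including the poles of the denominator factors.\<close>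

lemma fox_kernel_macrobert:
  "fox_kernel (length \<beta>s) 1 ((1, 1) # map (\<lambda>\<alpha>. (\<alpha>, 1)) \<alpha>s) (map (\<lambda>\<beta>. (\<beta>, 1)) \<beta>s) s =
     (\<Prod>\<beta>\<leftarrow>\<beta>s. Gamma (\<beta> + s)) * Gamma (- s) * (\<Prod>\<alpha>\<leftarrow>\<alpha>s. rGamma (\<alpha> + s))"
proof -
  let ?as = "(1, 1) # map (\<lambda>\<alpha>. (\<alpha>, 1)) \<alpha>s" and ?bs = "map (\<lambda>\<beta>. (\<beta>, 1)) \<beta>s"
  \<comment> \<open>Index \<open>0\<close> is the pair \<open>(1, 1)\<close>, already used in the
    numerator; shifting by one leaves exactly the entries of \<open>\<alpha>s\<close>.\<close>
  have "(\<Prod>j=1..<length ?as. Gamma (fst (?as ! j) + of_real (snd (?as ! j)) * s)) = (\<Prod>j<length \<alpha>s. Gamma (\<alpha>s ! j + s))"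
    unfolding One_nat_def list.size(4) length_map add_Suc_right add_0_right prod.atLeast_Suc_lessThan_Suc_shift
    by (simp add: atLeast0LessThan)
  also have "\<dots> = inverse (\<Prod>\<alpha>\<leftarrow>\<alpha>s. rGamma (\<alpha> + s))"
    using prod_lessThan_nth[of "\<lambda>\<alpha>. Gamma (\<alpha> + s)" \<alpha>s] by (simp add: rGamma_inverse_Gamma prod_list_inverse)
  finally have denominator: "(\<Prod>j=1..<length ?as. Gamma (fst (?as ! j) + of_real (snd (?as ! j)) * s)) =
      inverse (\<Prod>\<alpha>\<leftarrow>\<alpha>s. rGamma (\<alpha> + s))" .
  have "(\<Prod>j<length \<beta>s. Gamma (fst (?bs ! j) + of_real (snd (?bs ! j)) * s)) = (\<Prod>\<beta>\<leftarrow>\<beta>s. Gamma (\<beta> + s))"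
    using prod_lessThan_nth[of "\<lambda>\<beta>. Gamma (\<beta> + s)" \<beta>s] by simp
  then show ?thesis
    unfolding fox_kernel_def denominator by (simp add: divide_inverse)
qed

lemma holomorphic_on_prod_list:
  "(\<And>M. M \<in> set Ms \<Longrightarrow> M holomorphic_on A) \<Longrightarrow> (\<lambda>s. \<Prod>M\<leftarrow>Ms. M s) holomorphic_on A"
  by (induction Ms) (auto intro!: holomorphic_intros)

section \<open>The vertical line as a contour, and positivity\<close>

lemma vertical_contour_line: "vertical_contour \<rho> (Complex \<rho>)"
proof -
  have "((Complex \<rho>) has_vector_derivative \<i>) (at t)" for t
    unfolding Complex_eq by (auto intro!: derivative_eq_intros)
  then have "Complex \<rho> C1_differentiable_on {a..b}" for a b
    unfolding C1_differentiable_on_def by (intro exI[of _ "\<lambda>_. \<i>"]) auto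
  then show ?thesis
    by (auto simp: vertical_contour_def inj_def filterlim_ident intro: C1_differentiable_imp_piecewise)
qed

lemma left_of_line: "Re w < \<rho> \<Longrightarrow> w \<in> left_of (Complex \<rho>)"
  unfolding left_of_def mem_Collect_eq connected_component_def
  by (rule eventually_mono[OF eventually_gt_at_bot[of \<rho>]])
     (auto intro!: exI[of _ "{z. Re z < \<rho>}"] convex_connected convex_halfspace_Re_lt)

lemma right_of_line: "\<rho> < Re w \<Longrightarrow> w \<in> right_of (Complex \<rho>)"
  unfolding right_of_def mem_Collect_eq connected_component_def
  by (rule eventually_mono[OF eventually_gt_at_top[of \<rho>]])
     (auto intro!: exI[of _ "{z. \<rho> < Re z}"] convex_connected convex_halfspace_Re_gt)

text \<open>Each entry of \<open>c\<close> is paired with one of \<open>d\<close> to form a Beta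
  quotient, and the entries of \<open>b\<close> remain as single Gamma factors. The lower list is
  given only up to order, because the kernel is symmetric in it and the grouping by pairs need not
  match the order of the arguments.\<close>

theorem macrobert_E_pos:
  fixes b c d :: "real list" and t :: real
  assumes len: "length c = length d" and b: "b \<noteq> []" "\<And>\<beta>. \<beta> \<in> set b \<Longrightarrow> 0 < \<beta>"
    and c: "\<And>\<gamma>. \<gamma> \<in> set c \<Longrightarrow> 0 < \<gamma>" and cd: "\<And>\<gamma> \<delta>. (\<gamma>, \<delta>) \<in> set (zip c d) \<Longrightarrow> \<gamma> < \<delta>"
    and bs: "mset bs = mset (b @ c)" and t: "0 < t"
  shows "\<exists>r>0. macrobert_E (map complex_of_real bs) (map complex_of_real d) t = of_real r"
proof -
  have set_bs: "set bs = set b \<union> set c" using bs by (metis set_append set_mset_mset)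
  \<comment> \<open>With half of the smallest lower parameter, the line
    \<open>Re s = - \<epsilon>\<close> runs strictly between the left poles, whose largest real part
    is \<open>- Min (set bs)\<close>, and the right poles \<open>0, 1, 2, ...\<close>.\<close>
  define \<epsilon> where "\<epsilon> = Min (set bs) / 2"
  have pos: "\<beta> > 0" if "\<beta> \<in> set bs" for \<beta> using that b(2) c by (auto simp: set_bs)
  have "set bs \<noteq> {}" using b(1) set_bs by auto
  then have Min: "Min (set bs) > 0" using pos by (simp add: Min_gr_iff)
  have "\<epsilon> < \<beta>" if "\<beta> \<in> set bs" for \<beta>
    unfolding \<epsilon>_def using Min Min_le[OF _ that] by simp
  with Min have \<epsilon>: "\<epsilon> > 0" "\<And>\<beta>. \<beta> \<in> set bs \<Longrightarrow> \<epsilon> < \<beta>" by (simp_all add: \<epsilon>_def)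
  define Ms where "Ms = map (\<lambda>\<beta> s. Gamma (complex_of_real \<beta> + s)) b @
     map (\<lambda>(\<gamma>, \<delta>) s. Gamma (complex_of_real \<gamma> + s) * rGamma (of_real \<delta> + s)) (zip c d)"
  define K where "K s = Gamma (- s) * (\<Prod>M\<leftarrow>Ms. M s)" for s
  define F where "F s = K s * of_real t powr (- s)" for s
  define S where "S = {w. \<exists>\<beta>\<in>set bs. of_real \<beta> + w \<in> \<int>\<^sub>\<le>\<^sub>0} \<union> {w :: complex. - w \<in> \<int>\<^sub>\<le>\<^sub>0}"
  have kernel: "fox_kernel (length bs) 1 ((1, 1) # map (\<lambda>\<alpha>. (\<alpha>, 1)) (map complex_of_real d))
      (map (\<lambda>\<beta>. (\<beta>, 1)) (map complex_of_real bs)) s = K s" for s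
  proof -
    have "(\<Prod>\<beta>\<leftarrow>bs. Gamma (complex_of_real \<beta> + s)) = (\<Prod>\<beta>\<leftarrow>b @ c. Gamma (complex_of_real \<beta> + s))"
      using bs by (metis mset_map prod_mset_prod_list)
    moreover have "(\<Prod>M\<leftarrow>Ms. M s) = (\<Prod>\<beta>\<leftarrow>b. Gamma (complex_of_real \<beta> + s)) *
        (\<Prod>(\<gamma>, \<delta>)\<leftarrow>zip c d. Gamma (complex_of_real \<gamma> + s) * rGamma (of_real \<delta> + s))"
      by (simp add: Ms_def o_def case_prod_unfold)
    ultimately show ?thesis
      using fox_kernel_macrobert[of "map complex_of_real bs" "map complex_of_real d" s]
      by (simp add: K_def prod_list_zip_mult[OF len] o_def mult_ac)
  qed
  have factor: "strip_bounded M \<and> (\<exists>v. cf_of_density v (\<lambda>u. M (Complex (- \<epsilon>) u))) \<and> M holomorphic_on - S"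
    if "M \<in> set Ms" for M
  proof -
    have hG: "(\<lambda>s. Gamma (complex_of_real \<beta> + s)) holomorphic_on - S" if "\<beta> \<in> set bs" for \<beta>
      using that by (intro holomorphic_intros) (auto simp: S_def)
    from that consider (G) \<beta> where "\<beta> \<in> set b" "M = (\<lambda>s. Gamma (of_real \<beta> + s))"
      | (R) \<gamma> \<delta> where "(\<gamma>, \<delta>) \<in> set (zip c d)" "M = (\<lambda>s. Gamma (of_real \<gamma> + s) * rGamma (of_real \<delta> + s))"
      by (auto simp: Ms_def)
    then show ?thesis
    proof cases
      case G
      then have "\<beta> \<in> set bs" by (simp add: set_bs)
      with \<epsilon>(2)[OF this] show ?thesis
        unfolding G using strip_bounded_Gamma cf_of_density_Gamma[of "- \<epsilon>" \<beta>] hG by auto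
    next
      case R
      then have \<gamma>: "\<gamma> \<in> set bs" by (auto simp: set_bs dest: set_zip_leftD)
      have "\<gamma> < \<delta>" using cd R(1) by blast
      then obtain v where "cf_of_density v (\<lambda>u. Gamma (of_real \<gamma> + Complex (- \<epsilon>) u) * rGamma (of_real (\<gamma> + (\<delta> - \<gamma>)) + Complex (- \<epsilon>) u))"
        using cf_of_density_Gamma_ratio[of "- \<epsilon>" \<gamma> "\<delta> - \<gamma>"] \<epsilon>(2)[OF \<gamma>] by auto
      then show ?thesis
        unfolding R using strip_bounded_Gamma_ratio[OF \<open>\<gamma> < \<delta>\<close>]
        by (auto intro!: holomorphic_intros hG[OF \<gamma>])
    qed
  qed
  have "positive_fourier (\<lambda>u. K (Complex (- \<epsilon>) u))"
    unfolding K_def using positive_fourier_prod_list[OF positive_fourier_Gamma[OF \<epsilon>(1)]] factor by blast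
  then obtain r where r: "r > 0" "(LINT u|lborel. K (Complex (- \<epsilon>) u) * cis (- (u * ln t))) = of_real r"
    and iK: "integrable lborel (\<lambda>u. K (Complex (- \<epsilon>) u))"
    by (auto simp: positive_fourier_def)
  \<comment> \<open>On the line \<open>t powr (- s)\<close> is the constant
    \<open>t powr \<epsilon>\<close> times a character in \<open>u\<close>, so the contour integral
    is the transform of the kernel at \<open>y = ln t\<close>.\<close>
  have F_line: "F (Complex (- \<epsilon>) u) = of_real (t powr \<epsilon>) * (K (Complex (- \<epsilon>) u) * cis (- (u * ln t)))" for u
  proof -
    have "- Complex (- \<epsilon>) u = Complex \<epsilon> (- u)" by (simp add: complex_eq_iff)
    then show ?thesis using t by (simp add: F_def powr_Complex_of_real)
  qed
  have I: "(LINT u|lborel. F (Complex (- \<epsilon>) u)) = of_real (t powr \<epsilon> * r)"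
    unfolding F_line integral_mult_right_zero r(2) by simp
  have iF: "integrable lborel (\<lambda>u. F (Complex (- \<epsilon>) u))"
    unfolding F_line
    by (intro integrable_mult_right Bochner_Integration.integrable_bound[OF iK])
       (use iK in \<open>auto simp: norm_mult\<close>)
  have S_cases: "(\<exists>\<beta>\<in>set bs. \<exists>n :: nat. w = of_real (- \<beta> - real n)) \<or> (\<exists>n :: nat. w = of_real (real n))" if "w \<in> S" for w
  proof -
    from that consider \<beta> where "\<beta> \<in> set bs" "of_real \<beta> + w \<in> \<int>\<^sub>\<le>\<^sub>0" | "- w \<in> \<int>\<^sub>\<le>\<^sub>0" by (auto simp: S_def)
    then show ?thesis
    proof cases
      case 1
      then obtain n where "of_real \<beta> + w = - of_nat n" by (elim nonpos_Ints_cases')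
      then have "w = of_real (- \<beta> - real n)" by (simp add: algebra_simps eq_neg_iff_add_eq_0)
      with 1 show ?thesis by blast
    next
      case 2
      then obtain n where "- w = - of_nat n" by (elim nonpos_Ints_cases')
      then have "w = of_real (real n)" by simp
      then show ?thesis by blast
    qed
  qed
  have S: "closed S" "\<And>w. w \<in> S \<Longrightarrow> Im w = 0" "\<And>R. finite {w \<in> S. \<bar>Re w\<bar> \<le> R}"
  proof -
    have cl: "closed {w. a + k * w \<in> (\<int>\<^sub>\<le>\<^sub>0 :: complex set)}" for a k
      using continuous_closed_vimage[of "\<int>\<^sub>\<le>\<^sub>0" "\<lambda>w. a + k * w"]
      by (auto simp: vimage_def intro!: closed_subset_Ints continuous_intros)
    have "S = (\<Union>\<beta>\<in>set bs. {w. of_real \<beta> + 1 * w \<in> \<int>\<^sub>\<le>\<^sub>0}) \<union> {w. 0 + (-1) * w \<in> \<int>\<^sub>\<le>\<^sub>0}"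
      by (auto simp: S_def)
    also have "closed \<dots>" by (intro closed_Un closed_UN finite_set ballI cl)
    finally show "closed S" .
    show "Im w = 0" if "w \<in> S" for w using S_cases[OF that] by auto
    fix R
    have "{w \<in> S. \<bar>Re w\<bar> \<le> R} \<subseteq> (\<Union>\<beta>\<in>set bs. (\<lambda>n. of_real (- \<beta> - real n)) ` {..nat \<lceil>R\<rceil>}) \<union> (\<lambda>n. of_real (real n)) ` {..nat \<lceil>R\<rceil>}"
    proof
      fix w assume "w \<in> {w \<in> S. \<bar>Re w\<bar> \<le> R}"
      then have "w \<in> S" and R: "\<bar>Re w\<bar> \<le> R" by auto
      from S_cases[OF this(1)] consider (l) \<beta> n where "\<beta> \<in> set bs" "w = of_real (- \<beta> - real n)"
        | (r) n where "w = of_real (real n)" by blast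
      then show "w \<in> (\<Union>\<beta>\<in>set bs. (\<lambda>n. of_real (- \<beta> - real n)) ` {..nat \<lceil>R\<rceil>}) \<union> (\<lambda>n. of_real (real n)) ` {..nat \<lceil>R\<rceil>}"
      proof cases
        case l
        then have "\<bar>- \<beta> - real n\<bar> \<le> R" using R by (metis Re_complex_of_real)
        then have "n \<le> nat \<lceil>R\<rceil>" using pos[OF l(1)] by linarith
        then show ?thesis using l by blast
      next
        case r
        then have "real n \<le> R" using R by simp
        then have "n \<le> nat \<lceil>R\<rceil>" by linarith
        then show ?thesis using r by blast
      qed
    qed
    then show "finite {w \<in> S. \<bar>Re w\<bar> \<le> R}" by (rule finite_subset) auto
  qed
  have left: "Re w < - \<epsilon>" if "\<exists>\<beta>\<in>set bs. of_real \<beta> + w \<in> \<int>\<^sub>\<le>\<^sub>0" for w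
  proof -
    obtain \<beta> n where "\<beta> \<in> set bs" "of_real \<beta> + w = - of_nat n"
      using \<open>\<exists>\<beta>\<in>set bs. of_real \<beta> + w \<in> \<int>\<^sub>\<le>\<^sub>0\<close> by (auto elim!: nonpos_Ints_cases')
    then have "\<beta> + Re w = - real n" by (metis Re_complex_of_real minus_complex.sel(1) of_real_of_nat_eq plus_complex.sel(1) uminus_complex.sel(1))
    then show ?thesis using \<epsilon>(2)[OF \<open>\<beta> \<in> set bs\<close>] by linarith
  qed
  have right: "- \<epsilon> < Re w" if "- w \<in> \<int>\<^sub>\<le>\<^sub>0" for w :: complex
    using that \<epsilon>(1) by (auto elim!: nonpos_Ints_cases' simp: complex_eq_iff)
  have holo: "F holomorphic_on - S"
  proof -
    have "(\<lambda>s. \<Prod>M\<leftarrow>Ms. M s) holomorphic_on - S"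
      using factor by (intro holomorphic_on_prod_list) blast
    then show ?thesis
      unfolding F_def K_def using t by (intro holomorphic_intros) (auto simp: S_def)
  qed
  have decay: "\<exists>C. \<forall>s. \<bar>Re s\<bar> \<le> R \<longrightarrow> 1 \<le> \<bar>Im s\<bar> \<longrightarrow> norm (F s) \<le> C / (Im s)\<^sup>2" for R
  proof -
    obtain C where C: "C \<ge> 0" "\<And>w. \<bar>Re w\<bar> \<le> R \<Longrightarrow> 1 \<le> \<bar>Im w\<bar> \<Longrightarrow> norm (Gamma w) \<le> C / (Im w)\<^sup>2"
      using Gamma_decay_on_strip by blast
    obtain D where D: "D \<ge> 0" "\<And>s. \<bar>Re s\<bar> \<le> R \<Longrightarrow> 1 \<le> \<bar>Im s\<bar> \<Longrightarrow> norm (\<Prod>M\<leftarrow>Ms. M s) \<le> D"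
      using strip_boundedE[OF strip_bounded_prod_list[of Ms]] factor by blast
    have "norm (F s) \<le> C * D * exp (R * \<bar>ln t\<bar>) / (Im s)\<^sup>2" if s: "\<bar>Re s\<bar> \<le> R" "1 \<le> \<bar>Im s\<bar>" for s
    proof -
      have "- (Re s * ln t) \<le> \<bar>Re s\<bar> * \<bar>ln t\<bar>" by (metis abs_ge_minus_self abs_mult)
      also have "\<dots> \<le> R * \<bar>ln t\<bar>" using s by (intro mult_right_mono) auto
      finally have "norm (of_real t powr (- s)) \<le> exp (R * \<bar>ln t\<bar>)"
        using t by (simp add: norm_powr_real_powr powr_def)
      moreover have "norm (Gamma (- s)) \<le> C / (Im s)\<^sup>2" using C(2)[of "- s"] s by simp
      ultimately have "norm (F s) \<le> C / (Im s)\<^sup>2 * D * exp (R * \<bar>ln t\<bar>)"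
        unfolding F_def K_def norm_mult using D(2)[OF s] C(1) D(1) by (intro mult_mono) auto
      then show ?thesis by (simp add: mult_ac)
    qed
    then show ?thesis by blast
  qed
  \<comment> \<open>The factor \<open>\<i>\<close> of \<open>ds = \<i> du\<close> cancels against
    \<open>2 * pi * \<i>\<close>, leaving a positive real number.\<close>
  define h where "h = complex_of_real (t powr \<epsilon> * r / (2 * pi))"
  have h: "2 * of_real pi * \<i> * h = \<i> * (LINT u|lborel. F (Complex (- \<epsilon>) u))"
    unfolding I h_def by simp
  have "macrobert_E (map complex_of_real bs) (map complex_of_real d) t = h"
    unfolding macrobert_E_def fox_H_def length_map kernel left_poles_eq right_poles_eq
  proof (rule the_equality)
    have "vector_derivative (Complex (- \<epsilon>)) (at u) = \<i>" for u
      unfolding Complex_eq by (intro vector_derivative_at) (auto intro!: derivative_eq_intros)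
    moreover have "((\<lambda>u. F (Complex (- \<epsilon>) u) * \<i>) has_integral ((LINT u|lborel. F (Complex (- \<epsilon>) u)) * \<i>)) UNIV"
      by (intro has_integral_mult_left has_integral_integral_lborel iF)
    ultimately have "((\<lambda>u. F (Complex (- \<epsilon>) u) * vector_derivative (Complex (- \<epsilon>)) (at u)) has_integral
        2 * of_real pi * \<i> * h) UNIV"
      unfolding h by (simp add: mult.commute)
    then show "\<exists>\<gamma> g. vertical_contour \<gamma> g \<and> {w. \<exists>\<beta>\<in>set bs. of_real \<beta> + w \<in> \<int>\<^sub>\<le>\<^sub>0} \<subseteq> left_of g \<and>
        {w. - w \<in> \<int>\<^sub>\<le>\<^sub>0} \<subseteq> right_of g \<and>
        ((\<lambda>u. K (g u) * of_real t powr (- g u) * vector_derivative g (at u)) has_integral 2 * of_real pi * \<i> * h) UNIV"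
      using left left_of_line right right_of_line vertical_contour_line[of "- \<epsilon>"]
      unfolding F_def by blast
  next
    \<comment> \<open>Uniqueness: a competing value brings its own contour, whose integral is
      compared with the one along the line.\<close>
    fix h' assume "\<exists>\<gamma> g. vertical_contour \<gamma> g \<and> {w. \<exists>\<beta>\<in>set bs. of_real \<beta> + w \<in> \<int>\<^sub>\<le>\<^sub>0} \<subseteq> left_of g \<and>
        {w. - w \<in> \<int>\<^sub>\<le>\<^sub>0} \<subseteq> right_of g \<and>
        ((\<lambda>u. K (g u) * of_real t powr (- g u) * vector_derivative g (at u)) has_integral 2 * of_real pi * \<i> * h') UNIV"
    then obtain \<gamma> g where vc: "vertical_contour \<gamma> g"
      and lr: "{w. \<exists>\<beta>\<in>set bs. of_real \<beta> + w \<in> \<int>\<^sub>\<le>\<^sub>0} \<subseteq> left_of g" "{w. - w \<in> \<int>\<^sub>\<le>\<^sub>0} \<subseteq> right_of g"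
      and int: "((\<lambda>u. F (g u) * vector_derivative g (at u)) has_integral 2 * of_real pi * \<i> * h') UNIV"
      unfolding F_def by blast
    have "2 * of_real pi * \<i> * h' = \<i> * (LINT u|lborel. F (Complex (- \<epsilon>) u))"
      by (rule vertical_contour_integral_eq[OF vc S _ holo decay int])
         (use lr left right in \<open>auto simp: S_def\<close>)
    then have "(2 * of_real pi * \<i>) * h' = (2 * of_real pi * \<i>) * h" by (simp only: h)
    then show "h' = h" by (subst (asm) mult_left_cancel) auto
  qed
  moreover have "t powr \<epsilon> * r / (2 * pi) > 0" using t r(1) by simp
  ultimately show ?thesis unfolding h_def by blast
qed

theorem corollary6p4:
  fixes p q :: nat and b c d :: "real list" and o1 t :: real
  assumes "1 \<le> p" and "p \<le> q"
    and "length b = q - p" and "length c = p - 1" and "length d = p - 1"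
    and "\<forall>j < q - p. 0 \<le> b ! j"
    and "\<forall>j < p - 1. 0 \<le> c ! j"
    and "\<forall>j < p - 1. c ! j + 1 \<le> d ! j"
    and "0 \<le> o1"
    and "\<forall>\<beta> \<in> set (b @ c @ [o1]). \<forall>l l' :: nat. \<beta> + real l \<noteq> - real l'"
    and "0 < t"
  shows "macrobert_E (map complex_of_real (b @ c @ [o1])) (map complex_of_real d) t \<in> \<real> \<and>
         0 < Re (macrobert_E (map complex_of_real (b @ c @ [o1])) (map complex_of_real d) t)"
proof -
  \<comment> \<open>The case \<open>l = l' = 0\<close> of the hypothesis.\<close>
  have nz: "\<beta> \<noteq> 0" if "\<beta> \<in> set (b @ c @ [o1])" for \<beta>
    using assms(10) that by (metis add_0 neg_equal_0_iff_equal of_nat_0)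
  have "0 \<le> \<beta>" if "\<beta> \<in> set (b @ c @ [o1])" for \<beta>
    using that assms(3-9) by (auto simp: in_set_conv_nth)
  with nz have pos: "0 < \<beta>" if "\<beta> \<in> set (b @ c @ [o1])" for \<beta>
    using that by (simp add: order_less_le)
  have "\<exists>r>0. macrobert_E (map complex_of_real (b @ c @ [o1])) (map complex_of_real d) t = of_real r"
  \<comment> \<open>\<open>o1\<close> has no partner in \<open>d\<close> and joins the unpaired
    parameters, which makes that list non-empty even when \<open>p = q\<close>.\<close>
  proof (rule macrobert_E_pos[of c d "b @ [o1]"])
    show "\<gamma> < \<delta>" if "(\<gamma>, \<delta>) \<in> set (zip c d)" for \<gamma> \<delta>
      using that assms(4,5,8) by (force simp: in_set_zip)
  qed (use assms pos in auto)
  then show ?thesis by auto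
qed

end
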